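(* For every initial data $\alpha(0)\in h^1$ there exists a unique global-in-time solution $\alpha(t)\in C(\mathbb{R},h^1)$ of the conformal flow system $$i(n+1)\frac{d\alpha_n}{dt}=\sum_{j=0}^{\infty}\sum_{k=0}^{n+j}S_{njk,n+j-k}\,\bar\alpha_j\alpha_k\alpha_{n+j-k},\qquad n\in\mathbb{N}.$$ Moreover, for every $t\in\mathbb{R}$, $$H(\alpha(t))=H(\alpha(0)),\qquad Q(\alpha(t))=Q(\alpha(0)),\qquad E(\alpha(t))=E(\alpha(0)).$$
   Context: $\mathbb{N}=\{0,1,2,\dots\}$; $\alpha=(\alpha_n)_{n\in\mathbb{N}}$ is a complex sequence. For $s>0$, $h^s=\{\alpha\in\ell^2(\mathbb{N}):\sum_{n\ge0}(n+1)^{2s}|\alpha_n|^2<\infty\}$ with norm $\|\alpha\|_{h^s}^2=\sum_{n\ge 0}(n+1)^{2s}|\alpha_n|^2$. The coefficients are $S_{njk,n+j-k}=\min(n,j,k,n+j-k)+1$. A solution in $C(I,h^1)$ on an interval $I\ni 0$ is understood through the integral form $\alpha(t)=\alpha(0)-i\int_0^tF(\alpha(\tau))\,d\tau$, where $[F(\alpha)]_n=\sum_{j=0}^\infty\sum_{k=0}^{n+j}\frac{\min(n,j,k,n+j-k)+1}{n+1}\bar\alpha_j\alpha_k\alpha_{n+j-k}$. The functionals are $$H(\alpha)=\sum_{n=0}^{\infty}\sum_{j=0}^{\infty}\sum_{k=0}^{n+j}S_{njk,n+j-k}\,\bar\alpha_n\bar\alpha_j\alpha_k\alpha_{n+j-k},\quad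 Q(\alpha)=\sum_{n=0}^\infty(n+1)|\alpha_n|^2,\quad E(\alpha)=\sum_{n=0}^\infty(n+1)^2|\alpha_n|^2.$$ *)

theory Defs
  imports "HOL-Analysis.Analysis"
begin

section \<open>The weighted sequence spaces\<close>

definition hs :: "real \<Rightarrow> (nat \<Rightarrow> complex) set" where
  "hs s = {\<alpha>. summable (\<lambda>n. (norm (\<alpha> n))\<^sup>2) \<and>
                summable (\<lambda>n. (real n + 1) powr (2 * s) * (norm (\<alpha> n))\<^sup>2)}"

definition hs_norm :: "real \<Rightarrow> (nat \<Rightarrow> complex) \<Rightarrow> real" where
  "hs_norm s \<alpha> = sqrt (\<Sum>n. (real n + 1) powr (2 * s) * (norm (\<alpha> n))\<^sup>2)"

lemma weighted_term_eq:
  "(real n + 1) powr (2 * s) * (norm (z :: complex))\<^sup>2 = ((real n + 1) powr s * norm z)\<^sup>2"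
  by (simp add: power_mult_distrib powr_add[symmetric] power2_eq_square)

lemma summable_sq_add:
  fixes f g :: "nat \<Rightarrow> complex"
  assumes "\<And>n. 0 \<le> w n" "summable (\<lambda>n. w n * (norm (f n))\<^sup>2)" "summable (\<lambda>n. w n * (norm (g n))\<^sup>2)"
  shows "summable (\<lambda>n. w n * (norm (f n + g n))\<^sup>2)"
proof (rule summable_comparison_test')
  show "summable (\<lambda>n. 2 * (w n * (norm (f n))\<^sup>2) + 2 * (w n * (norm (g n))\<^sup>2))"
    using assms(2,3) by (intro summable_add summable_mult)
  fix n :: nat
  have "(norm (f n + g n))\<^sup>2 \<le> (norm (f n) + norm (g n))\<^sup>2"
    by (intro power_mono norm_triangle_ineq) auto
  also have "\<dots> \<le> 2 * (norm (f n))\<^sup>2 + 2 * (norm (g n))\<^sup>2"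
    using sum_squares_bound[of "norm (f n)" "norm (g n)"] by (simp add: power2_sum)
  finally have "w n * (norm (f n + g n))\<^sup>2 \<le> w n * (2 * (norm (f n))\<^sup>2 + 2 * (norm (g n))\<^sup>2)"
    using assms(1) by (intro mult_left_mono) auto
  then show "norm (w n * (norm (f n + g n))\<^sup>2) \<le> 2 * (w n * (norm (f n))\<^sup>2) + 2 * (w n * (norm (g n))\<^sup>2)"
    using assms(1) by (simp add: algebra_simps)
qed

lemma hs_zero: "(\<lambda>n. 0) \<in> hs s"
  by (simp add: hs_def)

lemma hs_add: "f \<in> hs s \<Longrightarrow> g \<in> hs s \<Longrightarrow> (\<lambda>n. f n + g n) \<in> hs s"
  using summable_sq_add[of "\<lambda>_. 1" f g] summable_sq_add[of "\<lambda>n. (real n + 1) powr (2 * s)" f g]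
  by (simp add: hs_def)

lemma hs_scale: "f \<in> hs s \<Longrightarrow> (\<lambda>n. c * f n) \<in> hs s"
  by (auto simp: hs_def norm_mult power_mult_distrib mult.left_commute intro!: summable_mult)

lemma hs_uminus: "f \<in> hs s \<Longrightarrow> (\<lambda>n. - f n) \<in> hs s"
  by (simp add: hs_def)

lemma hs_diff: "f \<in> hs s \<Longrightarrow> g \<in> hs s \<Longrightarrow> (\<lambda>n. f n - g n) \<in> hs s"
  using hs_add[OF _ hs_uminus[of g s], of f] by simp

lemma hs_scaleR: "f \<in> hs s \<Longrightarrow> (\<lambda>n. r *\<^sub>R f n) \<in> hs s"
  using hs_scale[of f s "of_real r"] by (simp add: scaleR_conv_of_real)

lemma hs_norm_LIMSEQ:
  assumes "f \<in> hs s"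
  shows "(\<lambda>N. L2_set (\<lambda>n. (real n + 1) powr s * norm (f n)) {..<N}) \<longlonglongrightarrow> hs_norm s f"
  using assms unfolding hs_def hs_norm_def L2_set_def
  by (auto simp flip: weighted_term_eq intro!: tendsto_real_sqrt summable_LIMSEQ)

lemma hs_norm_triangle:
  assumes "f \<in> hs s" "g \<in> hs s"
  shows "hs_norm s (\<lambda>n. f n + g n) \<le> hs_norm s f + hs_norm s g"
proof (rule LIMSEQ_le[OF hs_norm_LIMSEQ[OF hs_add[OF assms]]
        tendsto_add[OF hs_norm_LIMSEQ[OF assms(1)] hs_norm_LIMSEQ[OF assms(2)]]], intro exI allI impI)
  fix N :: nat
  have "L2_set (\<lambda>n. (real n + 1) powr s * norm (f n + g n)) {..<N}
      \<le> L2_set (\<lambda>n. (real n + 1) powr s * norm (f n) + (real n + 1) powr s * norm (g n)) {..<N}"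
    by (intro L2_set_mono) (auto simp flip: distrib_left intro!: mult_left_mono norm_triangle_ineq)
  also have "\<dots> \<le> L2_set (\<lambda>n. (real n + 1) powr s * norm (f n)) {..<N}
      + L2_set (\<lambda>n. (real n + 1) powr s * norm (g n)) {..<N}"
    by (rule L2_set_triangle_ineq)
  finally show "L2_set (\<lambda>n. (real n + 1) powr s * norm (f n + g n)) {..<N}
      \<le> L2_set (\<lambda>n. (real n + 1) powr s * norm (f n)) {..<N}
      + L2_set (\<lambda>n. (real n + 1) powr s * norm (g n)) {..<N}" .
qed

lemma hs_norm_eq_0_iff:
  assumes "f \<in> hs s"
  shows "hs_norm s f = 0 \<longleftrightarrow> (\<forall>n. f n = 0)"
proof -
  have "hs_norm s f = 0 \<longleftrightarrow> (\<forall>n. (real n + 1) powr (2 * s) * (norm (f n))\<^sup>2 = 0)"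
    using assms unfolding hs_norm_def hs_def by (simp add: suminf_eq_zero_iff)
  also have "\<dots> \<longleftrightarrow> (\<forall>n. f n = 0)"
    by auto
  finally show ?thesis .
qed

lemma hs_norm_scaleR:
  assumes "f \<in> hs s"
  shows "hs_norm s (\<lambda>n. r *\<^sub>R f n) = \<bar>r\<bar> * hs_norm s f"
proof -
  have "(\<Sum>n. (real n + 1) powr (2 * s) * (norm (r *\<^sub>R f n))\<^sup>2)
      = r\<^sup>2 * (\<Sum>n. (real n + 1) powr (2 * s) * (norm (f n))\<^sup>2)"
    using assms by (subst suminf_mult[symmetric]) (auto simp: hs_def power_mult_distrib mult_ac)
  then show ?thesis
    by (simp add: hs_norm_def real_sqrt_mult)
qed


section \<open>The space \<open>h\<^sup>1\<close> as a normed space\<close>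

typedef h1 = "hs 1"
  morphisms h1_coeff Abs_h1
  using hs_zero by blast

setup_lifting type_definition_h1

instantiation h1 :: real_normed_vector
begin

lift_definition zero_h1 :: h1 is "\<lambda>n. 0" by (rule hs_zero)

lift_definition plus_h1 :: "h1 \<Rightarrow> h1 \<Rightarrow> h1" is "\<lambda>f g n. f n + g n" by (rule hs_add)

lift_definition minus_h1 :: "h1 \<Rightarrow> h1 \<Rightarrow> h1" is "\<lambda>f g n. f n - g n" by (rule hs_diff)

lift_definition uminus_h1 :: "h1 \<Rightarrow> h1" is "\<lambda>f n. - f n" by (rule hs_uminus)

lift_definition scaleR_h1 :: "real \<Rightarrow> h1 \<Rightarrow> h1" is "\<lambda>r f n. r *\<^sub>R f n" by (rule hs_scaleR)

lift_definition norm_h1 :: "h1 \<Rightarrow> real" is "hs_norm 1" .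

definition dist_h1 :: "h1 \<Rightarrow> h1 \<Rightarrow> real" where
  "dist_h1 f g = norm (f - g)"

definition sgn_h1 :: "h1 \<Rightarrow> h1" where
  "sgn_h1 f = inverse (norm f) *\<^sub>R f"

definition uniformity_h1 :: "(h1 \<times> h1) filter" where
  "uniformity_h1 = (INF e\<in>{0 <..}. principal {(x, y). dist x y < e})"

definition open_h1 :: "h1 set \<Rightarrow> bool" where
  "open_h1 U = (\<forall>x\<in>U. \<forall>\<^sub>F (x', y) in uniformity. x' = x \<longrightarrow> y \<in> U)"

instance
proof
  fix f g :: h1 and r :: real
  show "norm f = 0 \<longleftrightarrow> f = 0"
    by transfer (auto simp: hs_norm_eq_0_iff)
  show "norm (f + g) \<le> norm f + norm g"
    by transfer (rule hs_norm_triangle)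
  show "norm (r *\<^sub>R f) = \<bar>r\<bar> * norm f"
    by transfer (rule hs_norm_scaleR)
  show "dist f g = norm (f - g)" by (rule dist_h1_def)
  show "sgn f = inverse (norm f) *\<^sub>R f" by (rule sgn_h1_def)
  show "(uniformity :: (h1 \<times> h1) filter) = (INF e\<in>{0 <..}. principal {(x, y). dist x y < e})"
    by (rule uniformity_h1_def)
  show "open U = (\<forall>x\<in>U. \<forall>\<^sub>F (x', y) in uniformity. x' = x \<longrightarrow> y \<in> U)" for U :: "h1 set"
    by (rule open_h1_def)
qed (transfer; simp add: algebra_simps fun_eq_iff)+

end

lift_definition h1_scaleC :: "complex \<Rightarrow> h1 \<Rightarrow> h1" is "\<lambda>c f n. c * f n"
  by (rule hs_scale)


section \<open>The conformal flow\<close>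

text \<open>The interaction coefficient with indices \<open>n, j, k, n + j - k\<close>; it is used only for
  \<open>k \<le> n + j\<close>, where the subtraction of natural numbers is exact.\<close>

definition conformal_S :: "nat \<Rightarrow> nat \<Rightarrow> nat \<Rightarrow> nat" where
  "conformal_S n j k = Min {n, j, k, n + j - k} + 1"

definition conformal_F_seq :: "(nat \<Rightarrow> complex) \<Rightarrow> nat \<Rightarrow> complex" where
  "conformal_F_seq \<alpha> n =
    (\<Sum>j. \<Sum>k = 0..n + j. of_nat (conformal_S n j k) / of_nat (n + 1) * (cnj (\<alpha> j) * \<alpha> k * \<alpha> (n + j - k)))"

lemma h1_summable_weighted: "\<alpha> \<in> hs 1 \<Longrightarrow> summable (\<lambda>n. ((real n + 1) * norm (\<alpha> n))\<^sup>2)"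
  by (simp add: hs_def power_mult_distrib)

lemma h1_summable_norm:
  assumes "\<alpha> \<in> hs 1"
  shows "summable (\<lambda>n. norm (\<alpha> n))"
proof (rule summable_comparison_test')
  have "summable (\<lambda>n. inverse (real (Suc n) ^ 2))"
    using inverse_power_summable[of 2, where 'a = real] by (subst summable_Suc_iff) auto
  then show "summable (\<lambda>n. ((real n + 1) * norm (\<alpha> n))\<^sup>2 + inverse (real (Suc n) ^ 2))"
    using h1_summable_weighted[OF assms] by (intro summable_add)
  fix n :: nat
  define x y where "x = (real n + 1) * norm (\<alpha> n)" and "y = inverse (real (Suc n))"
  have "norm (\<alpha> n) = x * y"
    by (simp add: x_def y_def field_simps)
  also have "\<dots> \<le> x\<^sup>2 + y\<^sup>2"
  proof -
    have "2 * (x * y) \<le> x\<^sup>2 + y\<^sup>2" "0 \<le> x * y"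
      using sum_squares_bound[of x y] by (simp_all only: mult.assoc) (simp add: x_def y_def)
    then show ?thesis by linarith
  qed
  finally show "norm (norm (\<alpha> n)) \<le> ((real n + 1) * norm (\<alpha> n))\<^sup>2 + inverse (real (Suc n) ^ 2)"
    by (simp add: x_def y_def power_inverse)
qed

lemma conformal_F_inner_bound:
  "norm (\<Sum>k = 0..n + j. of_nat (conformal_S n j k) / of_nat (n + 1) * (cnj (\<alpha> j) * \<alpha> k * \<alpha> (n + j - k)))
    \<le> ((real j + 1) * norm (\<alpha> j)) * (\<Sum>k\<le>n + j. norm (\<alpha> k) * norm (\<alpha> (n + j - k))) / (real n + 1)"
proof -
  have S: "real (conformal_S n j k) \<le> real j + 1" for k
    by (simp add: conformal_S_def)
  have "norm (\<Sum>k = 0..n + j. of_nat (conformal_S n j k) / of_nat (n + 1) * (cnj (\<alpha> j) * \<alpha> k * \<alpha> (n + j - k)))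
    \<le> (\<Sum>k = 0..n + j. norm (of_nat (conformal_S n j k) / of_nat (n + 1) * (cnj (\<alpha> j) * \<alpha> k * \<alpha> (n + j - k))))"
    by (rule norm_sum)
  also have "\<dots> = (\<Sum>k = 0..n + j. real (conformal_S n j k) / (real n + 1) * (norm (\<alpha> j) * norm (\<alpha> k) * norm (\<alpha> (n + j - k))))"
    by (intro sum.cong refl, simp only: norm_mult norm_divide norm_of_nat complex_mod_cnj)
      (simp add: add.commute)
  also have "\<dots> \<le> (\<Sum>k = 0..n + j. (real j + 1) / (real n + 1) * (norm (\<alpha> j) * norm (\<alpha> k) * norm (\<alpha> (n + j - k))))"
    by (intro sum_mono mult_right_mono divide_right_mono S) auto
  also have "\<dots> = ((real j + 1) * norm (\<alpha> j)) * (\<Sum>k\<le>n + j. norm (\<alpha> k) * norm (\<alpha> (n + j - k))) / (real n + 1)"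
    by (simp add: sum_distrib_left sum_distrib_right sum_divide_distrib atLeast0AtMost mult_ac)
  finally show ?thesis .
qed

lemma conformal_F_summable:
  assumes "\<alpha> \<in> hs 1"
  shows "summable (\<lambda>j. norm (\<Sum>k = 0..n + j.
    of_nat (conformal_S n j k) / of_nat (n + 1) * (cnj (\<alpha> j) * \<alpha> k * \<alpha> (n + j - k))))"
    and "summable (\<lambda>j. ((real j + 1) * norm (\<alpha> j)) * (\<Sum>k\<le>n + j. norm (\<alpha> k) * norm (\<alpha> (n + j - k))))"
proof -
  define b where "b j = (real j + 1) * norm (\<alpha> j)" for j
  define c where "c m = (\<Sum>k\<le>m. norm (\<alpha> k) * norm (\<alpha> (m - k)))" for m
  have "summable c"
    unfolding c_def using h1_summable_norm[OF assms] by (intro summable_Cauchy_product) auto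
  then have c: "summable (\<lambda>j. c (n + j))"
    using summable_iff_shift[of c n] by (simp add: add.commute)
  have "(\<lambda>j. (b j)\<^sup>2) \<longlonglongrightarrow> 0"
    using summable_LIMSEQ_zero[OF h1_summable_weighted[OF assms]] by (simp add: b_def)
  then have "Bseq (\<lambda>j. (b j)\<^sup>2)"
    using convergent_imp_Bseq convergentI by blast
  then obtain K where K: "K > 0" "\<And>j. norm ((b j)\<^sup>2) \<le> K"
    by (auto simp: Bseq_def)
  have b: "b j \<le> K + 1" for j
  proof -
    have "b j \<le> (b j)\<^sup>2 + 1"
    proof -
      have "2 * b j \<le> (b j)\<^sup>2 + 1" "0 \<le> b j"
        using sum_squares_bound[of "b j" 1] by (simp_all add: b_def)
      then show ?thesis by linarith
    qed
    then show ?thesis using K(2)[of j] by simp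
  qed
  have "summable (\<lambda>j. b j * c (n + j))"
  proof (rule summable_comparison_test')
    show "summable (\<lambda>j. (K + 1) * c (n + j))" using c by (rule summable_mult)
    show "norm (b j * c (n + j)) \<le> (K + 1) * c (n + j)" for j :: nat
    proof -
      have "0 \<le> b j" "0 \<le> c (n + j)"
        by (auto simp: b_def c_def intro!: sum_nonneg)
      then show ?thesis
        using b[of j] by (simp add: mult_right_mono)
    qed
  qed
  then show s: "summable (\<lambda>j. ((real j + 1) * norm (\<alpha> j)) * (\<Sum>k\<le>n + j. norm (\<alpha> k) * norm (\<alpha> (n + j - k))))"
    by (simp add: b_def c_def)
  show "summable (\<lambda>j. norm (\<Sum>k = 0..n + j.
    of_nat (conformal_S n j k) / of_nat (n + 1) * (cnj (\<alpha> j) * \<alpha> k * \<alpha> (n + j - k))))"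
    by (rule summable_comparison_test'[OF summable_divide[OF s, of "real n + 1"]])
      (use conformal_F_inner_bound[where \<alpha> = \<alpha> and n = n] in simp)
qed

lemma conformal_F_hs:
  assumes "\<alpha> \<in> hs 1"
  shows "conformal_F_seq \<alpha> \<in> hs 1"
proof -
  define b where "b j = (real j + 1) * norm (\<alpha> j)" for j
  define c where "c m = (\<Sum>k\<le>m. norm (\<alpha> k) * norm (\<alpha> (m - k)))" for m
  define g where "g n = (\<Sum>j. b j * c (n + j))" for n
  define C where "C = suminf c"
  define B where "B = (\<Sum>j. (b j)\<^sup>2)"
  have c: "summable c"
    unfolding c_def using h1_summable_norm[OF assms] by (intro summable_Cauchy_product) auto
  have b: "summable (\<lambda>j. (b j)\<^sup>2)"
    unfolding b_def by (rule h1_summable_weighted[OF assms])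
  have c0: "0 \<le> c m" and b0: "0 \<le> b m" for m
    by (auto simp: b_def c_def intro!: sum_nonneg)
  have C0: "0 \<le> C"
    unfolding C_def using c c0 by (rule suminf_nonneg)
  have cC: "(\<Sum>i<N. c (m + i)) \<le> C" for m N
  proof -
    have "(\<Sum>i<N. c (m + i)) = sum c ((+) m ` {..<N})"
      by (subst sum.reindex) auto
    also have "\<dots> \<le> C"
      unfolding C_def by (rule sum_le_suminf[OF c]) (auto simp: c0)
    finally show ?thesis .
  qed
  have bc: "summable (\<lambda>j. b j * c (n + j))" for n
    unfolding b_def c_def by (rule conformal_F_summable(2)[OF assms])
  have fin: "(\<Sum>n<N. (\<Sum>j<J. b j * c (n + j))\<^sup>2) \<le> C * (B * C)" for N J
  proof -
    have "(\<Sum>j<J. b j * c (n + j))\<^sup>2 \<le> (\<Sum>j<J. (b j)\<^sup>2 * c (n + j)) * C" for n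
    proof -
      have "(\<Sum>j<J. b j * c (n + j))\<^sup>2 = (\<Sum>j<J. (b j * sqrt (c (n + j))) * sqrt (c (n + j)))\<^sup>2"
        by (simp add: mult.assoc c0)
      also have "\<dots> \<le> (\<Sum>j<J. (b j * sqrt (c (n + j)))\<^sup>2) * (\<Sum>j<J. (sqrt (c (n + j)))\<^sup>2)"
        by (rule Cauchy_Schwarz_ineq_sum)
      also have "\<dots> = (\<Sum>j<J. (b j)\<^sup>2 * c (n + j)) * (\<Sum>j<J. c (n + j))"
        by (simp add: power_mult_distrib c0)
      also have "\<dots> \<le> (\<Sum>j<J. (b j)\<^sup>2 * c (n + j)) * C"
        by (intro mult_left_mono cC sum_nonneg) (simp add: c0)
      finally show ?thesis .
    qed
    then have "(\<Sum>n<N. (\<Sum>j<J. b j * c (n + j))\<^sup>2) \<le> (\<Sum>n<N. (\<Sum>j<J. (b j)\<^sup>2 * c (n + j)) * C)"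
      by (intro sum_mono)
    also have "\<dots> = C * (\<Sum>j<J. (b j)\<^sup>2 * (\<Sum>n<N. c (j + n)))"
      by (subst sum_distrib_right[symmetric], subst sum.swap) (simp add: sum_distrib_left add.commute mult.commute)
    also have "\<dots> \<le> C * (\<Sum>j<J. (b j)\<^sup>2 * C)"
      by (intro mult_left_mono sum_mono cC C0) auto
    also have "\<dots> = C * ((\<Sum>j<J. (b j)\<^sup>2) * C)"
      by (simp add: sum_distrib_right)
    also have "\<dots> \<le> C * (B * C)"
      unfolding B_def by (intro mult_left_mono mult_right_mono sum_le_suminf b C0) auto
    finally show ?thesis .
  qed
  have g: "(\<Sum>n<N. (g n)\<^sup>2) \<le> C * (B * C)" for N
  proof (rule LIMSEQ_le_const2)
    show "(\<lambda>J. \<Sum>n<N. (\<Sum>j<J. b j * c (n + j))\<^sup>2) \<longlonglongrightarrow> (\<Sum>n<N. (g n)\<^sup>2)"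
      unfolding g_def by (intro tendsto_sum tendsto_power summable_LIMSEQ bc)
    show "\<exists>M. \<forall>J\<ge>M. (\<Sum>n<N. (\<Sum>j<J. b j * c (n + j))\<^sup>2) \<le> C * (B * C)"
      using fin by blast
  qed
  have gs: "summable (\<lambda>n. (g n)\<^sup>2)"
    by (rule summableI_nonneg_bounded[OF _ g]) auto
  have Fg: "(real n + 1) * norm (conformal_F_seq \<alpha> n) \<le> g n" for n
  proof -
    have "norm (conformal_F_seq \<alpha> n) \<le> (\<Sum>j. b j * c (n + j) / (real n + 1))"
      unfolding conformal_F_seq_def
    proof (rule order_trans[OF summable_norm suminf_le])
      show "summable (\<lambda>j. b j * c (n + j) / (real n + 1))"
        using bc by (rule summable_divide)
    qed (use conformal_F_inner_bound[where \<alpha> = \<alpha> and n = n] conformal_F_summable(1)[OF assms] in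
        \<open>auto simp: b_def c_def\<close>)
    also have "\<dots> = g n / (real n + 1)"
      unfolding g_def using bc by (rule suminf_divide)
    finally show ?thesis by (simp add: field_simps)
  qed
  have w: "summable (\<lambda>n. ((real n + 1) * norm (conformal_F_seq \<alpha> n))\<^sup>2)"
    by (rule summable_comparison_test'[OF gs]) (auto simp del: power_mult_distrib intro!: power_mono Fg)
  moreover have "summable (\<lambda>n. (norm (conformal_F_seq \<alpha> n))\<^sup>2)"
    by (rule summable_comparison_test'[OF w])
      (auto intro!: power_mono simp: mult_le_cancel_right1)
  ultimately show ?thesis
    by (simp add: hs_def power_mult_distrib)
qed

text \<open>The nonlinearity \<open>F\<close> as a self-map of \<open>h\<^sup>1\<close>.\<close>

lift_definition conformal_F :: "h1 \<Rightarrow> h1" is conformal_F_seq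
  by (rule conformal_F_hs)

text \<open>\<open>has_oriented_integral_from_0 f t y\<close> says that \<open>y\<close> is the integral of \<open>f\<close> from \<open>0\<close> to \<open>t\<close>,
  where \<open>t\<close> may be negative.\<close>

definition has_oriented_integral_from_0 :: "(real \<Rightarrow> 'a::real_normed_vector) \<Rightarrow> real \<Rightarrow> 'a \<Rightarrow> bool" where
  "has_oriented_integral_from_0 f t y \<longleftrightarrow>
    (if 0 \<le> t then (f has_integral y) {0..t} else (f has_integral - y) {t..0})"

text \<open>Solutions in \<open>C(I, h\<^sup>1)\<close>, in the integral form of the system
  \<open>i (n + 1) d\<alpha>\<^sub>n/dt = \<Sum>\<^sub>j \<Sum>\<^sub>k S\<^sub>n\<^sub>j\<^sub>k cnj \<alpha>\<^sub>j \<alpha>\<^sub>k \<alpha>\<^sub>n\<^sub>+\<^sub>j\<^sub>-\<^sub>k\<close>; the integral is taken in the normed space \<open>h\<^sup>1\<close>.\<close>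

definition conformal_flow_solution :: "real set \<Rightarrow> (real \<Rightarrow> h1) \<Rightarrow> bool" where
  "conformal_flow_solution I \<alpha> \<longleftrightarrow>
    is_interval I \<and> 0 \<in> I \<and> continuous_on I \<alpha> \<and>
    (\<forall>t\<in>I. \<exists>y. has_oriented_integral_from_0 (\<lambda>\<tau>. conformal_F (\<alpha> \<tau>)) t y \<and>
                \<alpha> t = \<alpha> 0 - h1_scaleC \<i> y)"

definition conformal_H :: "(nat \<Rightarrow> complex) \<Rightarrow> complex" where
  "conformal_H \<alpha> =
    (\<Sum>n. \<Sum>j. \<Sum>k = 0..n + j. of_nat (conformal_S n j k) * (cnj (\<alpha> n) * cnj (\<alpha> j) * \<alpha> k * \<alpha> (n + j - k)))"

text \<open>On \<open>h\<^sup>1\<close> the iterated series defining \<open>H\<close> converges.\<close>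

lemma conformal_H_summable:
  assumes "\<alpha> \<in> hs 1"
  shows "summable (\<lambda>j. \<Sum>k = 0..n + j.
      of_nat (conformal_S n j k) * (cnj (\<alpha> n) * cnj (\<alpha> j) * \<alpha> k * \<alpha> (n + j - k)))" (is "summable (?h n)")
    and "summable (\<lambda>n. \<Sum>j. \<Sum>k = 0..n + j.
      of_nat (conformal_S n j k) * (cnj (\<alpha> n) * cnj (\<alpha> j) * \<alpha> k * \<alpha> (n + j - k)))"
proof -
  define f where "f n j = (\<Sum>k = 0..n + j.
    of_nat (conformal_S n j k) / of_nat (n + 1) * (cnj (\<alpha> j) * \<alpha> k * \<alpha> (n + j - k)))" for n j
  have f: "summable (f n)" for n
    using conformal_F_summable(1)[OF assms, of n] unfolding f_def by (rule summable_norm_cancel)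
  have hf: "?h n = (\<lambda>j. of_nat (n + 1) * cnj (\<alpha> n) * f n j)" for n
    unfolding f_def sum_distrib_left
    by (intro ext sum.cong refl) (simp add: field_simps del: of_nat_Suc of_nat_add)
  show "summable (?h n)"
    unfolding hf by (intro summable_mult f)
  have "suminf (?h n) = of_nat (n + 1) * cnj (\<alpha> n) * conformal_F_seq \<alpha> n" for n
    unfolding hf conformal_F_seq_def f_def[symmetric] by (rule suminf_mult[OF f])
  moreover have "summable (\<lambda>n. of_nat (n + 1) * cnj (\<alpha> n) * conformal_F_seq \<alpha> n)"
  proof (rule summable_comparison_test')
    show "summable (\<lambda>n. ((real n + 1) * norm (\<alpha> n))\<^sup>2 + ((real n + 1) * norm (conformal_F_seq \<alpha> n))\<^sup>2)"
      by (intro summable_add h1_summable_weighted conformal_F_hs assms)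
    fix n :: nat
    define x y where "x = (real n + 1) * norm (\<alpha> n)" and "y = norm (conformal_F_seq \<alpha> n)"
    have "norm (of_nat (n + 1) * cnj (\<alpha> n) * conformal_F_seq \<alpha> n) = x * y"
      by (simp only: norm_mult norm_of_nat complex_mod_cnj x_def y_def) (simp add: add.commute)
    also have "\<dots> \<le> x * ((real n + 1) * y)"
      by (intro mult_left_mono) (auto simp: x_def y_def mult_le_cancel_right1)
    also have "\<dots> \<le> x\<^sup>2 + ((real n + 1) * y)\<^sup>2"
    proof -
      have "2 * (x * ((real n + 1) * y)) \<le> x\<^sup>2 + ((real n + 1) * y)\<^sup>2" "0 \<le> x * ((real n + 1) * y)"
        using sum_squares_bound[of x "(real n + 1) * y"]
        by (simp_all only: mult.assoc) (simp add: x_def y_def)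
      then show ?thesis by linarith
    qed
    finally show "norm (of_nat (n + 1) * cnj (\<alpha> n) * conformal_F_seq \<alpha> n)
        \<le> ((real n + 1) * norm (\<alpha> n))\<^sup>2 + ((real n + 1) * norm (conformal_F_seq \<alpha> n))\<^sup>2"
      by (simp add: x_def y_def)
  qed
  ultimately show "summable (\<lambda>n. suminf (?h n))"
    by simp
qed

definition conformal_Q :: "(nat \<Rightarrow> complex) \<Rightarrow> real" where
  "conformal_Q \<alpha> = (\<Sum>n. (real n + 1) * (norm (\<alpha> n))\<^sup>2)"

definition conformal_E :: "(nat \<Rightarrow> complex) \<Rightarrow> real" where
  "conformal_E \<alpha> = (\<Sum>n. (real n + 1)\<^sup>2 * (norm (\<alpha> n))\<^sup>2)"

end

theory Submission
  imports Defs
begin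

text \<open>The nonlinearity is a bounded real-trilinear map on \<open>h\<^sup>1\<close>: since \<open>S \<le> j + 1\<close>, its \<open>n\<close>-th coefficient
  times \<open>n + 1\<close> is dominated by a Hankel form \<open>\<Sum>\<^sub>j y\<^sub>j c\<^sub>n\<^sub>+\<^sub>j\<close> with \<open>y\<close> in \<open>\<ell>\<^sup>2\<close> and \<open>c\<close>, a convolution,
  in \<open>\<ell>\<^sup>1\<close>. The same bound makes the quartic sums against \<open>(n + 1)\<^sup>2 cnj \<alpha>\<^sub>n\<close> absolutely
  convergent, so the symmetries of \<open>S\<close> give the conservation laws directly in \<open>h\<^sup>1\<close>. As
  \<open>E = \<parallel>\<alpha>\<parallel>\<^sup>2\<close>, the solution cannot leave a sphere. Precomposing the vector field \<open>V\<close> with the radial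
  retraction onto a ball makes it globally Lipschitz, and since \<open>V\<close> is homogeneous it only rescales
  \<open>V\<close>, so the norm is still conserved and the truncated flow is the original one.\<close>

section \<open>Global solutions of Lipschitz differential equations\<close>

text \<open>The functional counterpart of \<open>has_oriented_integral_from_0\<close>: a value
  instead of a relation, so that a Picard operator can be written down. It is applied to continuous
  integrands, where the integrals exist.\<close>

definition primitive_from_0 :: "(real \<Rightarrow> 'a::banach) \<Rightarrow> real \<Rightarrow> 'a" where
  "primitive_from_0 f t = (if 0 \<le> t then integral {0..t} f else - integral {t..0} f)"

lemma primitive_from_0_0 [simp]: "primitive_from_0 f 0 = 0"
  by (simp add: primitive_from_0_def)

text \<open>The two branches of the definition meet at 0. Moving the base point to
  \<open>-N\<close>, left of both 0 and t, gives a single formula up to a constant, to which the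
  fundamental theorem applies without a case distinction at 0.\<close>

lemma primitive_from_0_has_vector_derivative:
  assumes f: "continuous_on UNIV f"
  shows "(primitive_from_0 f has_vector_derivative f t) (at t)"
proof -
  define N where "N = \<bar>t\<bar> + 1"
  have fN: "continuous_on {-N..N} f"
    by (rule continuous_on_subset[OF f subset_UNIV])
  have int: "f integrable_on {a..b}" for a b
    by (rule integrable_continuous_real[OF continuous_on_subset[OF f subset_UNIV]])
  have eq: "integral {-N..u} f - integral {-N..0} f = primitive_from_0 f u" if "-N < u" for u
  proof (cases "0 \<le> u")
    case True
    then show ?thesis
      using Henstock_Kurzweil_Integration.integral_combine[OF _ _ int, of "-N" 0 u] by (simp add: primitive_from_0_def N_def algebra_simps)
  next
    case False
    then show ?thesis
      using Henstock_Kurzweil_Integration.integral_combine[OF _ _ int, of "-N" u 0] that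
      by (simp add: primitive_from_0_def algebra_simps)
  qed
  have "((\<lambda>u. integral {-N..u} f - integral {-N..0} f) has_vector_derivative f t - 0) (at t within {-N..N})"
    by (intro has_vector_derivative_diff integral_has_vector_derivative fN has_vector_derivative_const)
      (auto simp: N_def)
  \<comment> \<open>On the open interval a derivative within the set is an ordinary
    derivative.\<close>
  then have "((\<lambda>u. integral {-N..u} f - integral {-N..0} f) has_vector_derivative f t) (at t within {-N<..<N})"
    by (auto intro: has_vector_derivative_within_subset)
  then have "(primitive_from_0 f has_vector_derivative f t) (at t within {-N<..<N})"
    by (rule has_vector_derivative_transform[rotated 2]) (use eq in \<open>auto simp: N_def\<close>)
  then show ?thesis
    by (subst (asm) has_vector_derivative_within_open) (auto simp: N_def)
qed

lemma primitive_from_0_eq_diff: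
  assumes "\<And>t. (g has_vector_derivative f t) (at t)"
  shows "primitive_from_0 f t = g t - g 0"
proof (cases "0 \<le> t")
  case True
  then have "(f has_integral g t - g 0) {0..t}"
    by (intro fundamental_theorem_of_calculus has_vector_derivative_at_within[OF assms])
  then show ?thesis
    using True by (simp add: primitive_from_0_def integral_unique)
next
  case False
  then have "(f has_integral g 0 - g t) {t..0}"
    by (intro fundamental_theorem_of_calculus has_vector_derivative_at_within[OF assms]) simp
  then show ?thesis
    using False by (simp add: primitive_from_0_def integral_unique)
qed

lemma primitive_from_0_diff:
  assumes "continuous_on UNIV f" "continuous_on UNIV g"
  shows "primitive_from_0 f t - primitive_from_0 g t = primitive_from_0 (\<lambda>s. f s - g s) t"
  using primitive_from_0_eq_diff[OF has_vector_derivative_diff[OF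
      primitive_from_0_has_vector_derivative[OF assms(1)]
      primitive_from_0_has_vector_derivative[OF assms(2)]], of t]
  by simp

text \<open>Integration preserves exponential growth of rate c and gains the factor 1 / c. Choosing
  c as twice the Lipschitz constant will make the Picard operator contract by 1/2.\<close>

lemma norm_primitive_from_0_le_exp:
  assumes f: "continuous_on UNIV f" and c: "0 < c" and K: "0 \<le> K"
    and le: "\<And>t. norm (f t) \<le> K * exp (c * \<bar>t\<bar>)"
  shows "norm (primitive_from_0 f t) \<le> K / c * exp (c * \<bar>t\<bar>)"
proof -
  have int: "f integrable_on {a..b}" for a b
    by (rule integrable_continuous_real[OF continuous_on_subset[OF f subset_UNIV]])
  have "norm (primitive_from_0 f t) \<le> K / c * (exp (c * \<bar>t\<bar>) - 1)"
  proof (cases "0 \<le> t")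
    case True
    have I: "((\<lambda>s. K * exp (c * s)) has_integral K / c * exp (c * t) - K / c * exp (c * 0)) {0..t}"
      using True c
      by (intro fundamental_theorem_of_calculus)
        (auto intro!: derivative_eq_intros simp flip: has_real_derivative_iff_has_vector_derivative)
    have "norm (integral {0..t} f) \<le> integral {0..t} (\<lambda>s. K * exp (c * s))"
    proof (rule integral_norm_bound_integral[OF int])
      show "norm (f s) \<le> K * exp (c * s)" if "s \<in> {0..t}" for s
        using le[of s] that by simp
    qed (use I in auto)
    then show ?thesis
      using True integral_unique[OF I] by (simp add: primitive_from_0_def algebra_simps)
  next
    case False
    have I: "((\<lambda>s. K * exp (- c * s)) has_integral - K / c * exp (- c * 0) - (- K / c * exp (- c * t))) {t..0}"
      using False c
      by (intro fundamental_theorem_of_calculus)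
        (auto intro!: derivative_eq_intros simp flip: has_real_derivative_iff_has_vector_derivative)
    have "norm (integral {t..0} f) \<le> integral {t..0} (\<lambda>s. K * exp (- c * s))"
    proof (rule integral_norm_bound_integral[OF int])
      show "norm (f s) \<le> K * exp (- c * s)" if "s \<in> {t..0}" for s
        using le[of s] that by simp
    qed (use I in auto)
    then show ?thesis
      using False integral_unique[OF I] by (simp add: primitive_from_0_def algebra_simps)
  qed
  also have "\<dots> \<le> K / c * exp (c * \<bar>t\<bar>)"
    using K c by (intro mult_left_mono) auto
  finally show ?thesis .
qed

lemma vector_derivative_imp_continuous_on:
  "(\<And>t. (f has_vector_derivative f' t) (at t)) \<Longrightarrow> continuous_on S f"
  using continuous_at_imp_continuous_on has_vector_derivative_continuous by blast

text \<open>The weight \<open>exp (-2 L |t|)\<close> turns the Picard operator into a contraction on the bounded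
  continuous functions on the whole line, so that no gluing of local solutions is needed.\<close>

lemma lipschitz_ode_global:
  fixes G :: "'a::banach \<Rightarrow> 'a"
  assumes L: "0 < L" and lip: "\<And>x y. norm (G x - G y) \<le> L * norm (x - y)"
  shows "\<exists>x. x 0 = a \<and> (\<forall>t. (x has_vector_derivative G (x t)) (at t)) \<and>
    (\<forall>y K. y 0 = a \<and> (\<forall>t. (y has_vector_derivative G (y t)) (at t)) \<and> (\<forall>t. norm (y t) \<le> K) \<longrightarrow> y = x)"
proof -
  define w where "w t = exp (2 * L * \<bar>t\<bar>)" for t
  have w0: "0 < w t" and w1: "1 \<le> w t" for t
    using L by (auto simp: w_def)
  have wc: "continuous_on S w" for S
    unfolding w_def by (intro continuous_intros)
  have Gc: "continuous_on UNIV G"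
  proof (rule lipschitz_on_continuous_on[of L])
    show "L-lipschitz_on UNIV G"
      using L lip by (intro lipschitz_onI) (auto simp: dist_norm)
  qed
  have Gx: "continuous_on UNIV (\<lambda>s. G (x s))" if "continuous_on UNIV x" for x :: "real \<Rightarrow> 'a"
    using continuous_on_compose2[OF Gc that] by auto
  \<comment> \<open>The Picard operator in the unknown u = x / w: a fixed point u corresponds to the
    solution x = w u of the integral equation.\<close>
  define \<Phi> where "\<Phi> u t = inverse (w t) *\<^sub>R (a + primitive_from_0 (\<lambda>s. G (w s *\<^sub>R u s)) t)" for u t
  have Gwu: "continuous_on UNIV (\<lambda>s. G (w s *\<^sub>R u s))" if "continuous_on UNIV u" for u :: "real \<Rightarrow> 'a"
    using that by (intro Gx continuous_intros wc)
  have scale: "norm (inverse (w t) *\<^sub>R z) \<le> K" if "norm z \<le> K * w t" for z :: 'a and t K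
    using that w0[of t] by (simp add: field_simps)
  have \<Phi>_bcontfun: "\<Phi> u \<in> bcontfun" if u: "continuous_on UNIV u" and K: "\<And>t. norm (u t) \<le> K" for u K
  proof (rule bcontfun_normI)
    define K' where "K' = norm (G 0) + L * K"
    have K0: "0 \<le> K" using K[of 0] norm_ge_zero order_trans by blast
    have "continuous_on UNIV (primitive_from_0 (\<lambda>s. G (w s *\<^sub>R u s)))"
      by (rule vector_derivative_imp_continuous_on[OF primitive_from_0_has_vector_derivative[OF Gwu[OF u]]])
    moreover have "w t \<noteq> 0" for t using w0[of t] by simp
    ultimately show "continuous_on UNIV (\<Phi> u)"
      unfolding \<Phi>_def by (intro continuous_intros wc) auto
    show "norm (\<Phi> u t) \<le> norm a + K' / (2 * L)" for t
      unfolding \<Phi>_def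
    proof (rule scale)
      \<comment> \<open>Lipschitz continuity gives linear growth of G, and w \<ge> 1 absorbs the
        constant \<open>norm (G 0)\<close> into the weight.\<close>
      have "norm (G (w s *\<^sub>R u s)) \<le> K' * exp (2 * L * \<bar>s\<bar>)" for s
      proof -
        have "norm (G (w s *\<^sub>R u s)) \<le> norm (G 0) + norm (G (w s *\<^sub>R u s) - G 0)"
          using norm_triangle_ineq[of "G 0" "G (w s *\<^sub>R u s) - G 0"] by simp
        also have "\<dots> \<le> norm (G 0) * w s + L * (w s * K)"
          using lip[of "w s *\<^sub>R u s" 0] w0[of s] w1[of s] K[of s] L
          by (intro add_mono order_trans[OF lip]) (auto intro!: mult_left_mono simp: mult_le_cancel_left1)
        finally show ?thesis
          by (simp add: K'_def w_def algebra_simps)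
      qed
      then have "norm (primitive_from_0 (\<lambda>s. G (w s *\<^sub>R u s)) t) \<le> K' / (2 * L) * exp (2 * L * \<bar>t\<bar>)"
        using L K0 by (intro norm_primitive_from_0_le_exp Gwu u) (auto simp: K'_def)
      moreover have "norm a \<le> norm a * w t"
        using w1[of t] by (simp add: mult_le_cancel_left1)
      ultimately show "norm (a + primitive_from_0 (\<lambda>s. G (w s *\<^sub>R u s)) t) \<le> (norm a + K' / (2 * L)) * w t"
        using norm_triangle_ineq[of a "primitive_from_0 (\<lambda>s. G (w s *\<^sub>R u s)) t"]
        by (simp add: w_def distrib_right)
    qed
  qed
  have \<Phi>_contraction: "norm (\<Phi> u t - \<Phi> v t) \<le> d / 2"
    if u: "continuous_on UNIV u" and v: "continuous_on UNIV v" and d: "\<And>s. norm (u s - v s) \<le> d" for u v d t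
  proof -
    have "norm (G (w s *\<^sub>R u s) - G (w s *\<^sub>R v s)) \<le> L * d * exp (2 * L * \<bar>s\<bar>)" for s
    proof -
      have "norm (G (w s *\<^sub>R u s) - G (w s *\<^sub>R v s)) \<le> L * (w s * norm (u s - v s))"
        using lip[of "w s *\<^sub>R u s" "w s *\<^sub>R v s"] w0[of s] by (simp add: scaleR_diff_right[symmetric])
      also have "\<dots> \<le> L * (w s * d)"
        using L w0[of s] d[of s] by (intro mult_left_mono) auto
      finally show ?thesis by (simp add: w_def mult_ac)
    qed
    moreover have "0 \<le> d" using d[of 0] norm_ge_zero order_trans by blast
    ultimately have "norm (primitive_from_0 (\<lambda>s. G (w s *\<^sub>R u s) - G (w s *\<^sub>R v s)) t)
        \<le> L * d / (2 * L) * exp (2 * L * \<bar>t\<bar>)"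
      using L by (intro norm_primitive_from_0_le_exp continuous_on_diff Gwu u v) auto
    then have "norm (inverse (w t) *\<^sub>R primitive_from_0 (\<lambda>s. G (w s *\<^sub>R u s) - G (w s *\<^sub>R v s)) t) \<le> d / 2"
      using L by (intro scale) (simp add: w_def)
    moreover have "\<Phi> u t - \<Phi> v t
        = inverse (w t) *\<^sub>R primitive_from_0 (\<lambda>s. G (w s *\<^sub>R u s) - G (w s *\<^sub>R v s)) t"
      unfolding \<Phi>_def by (simp add: scaleR_diff_right[symmetric] primitive_from_0_diff Gwu u v)
    ultimately show ?thesis by simp
  qed
  define \<Psi> where "\<Psi> u = Bcontfun (\<Phi> (apply_bcontfun u))" for u :: "real \<Rightarrow>\<^sub>C 'a"
  have \<Psi>: "apply_bcontfun (\<Psi> u) = \<Phi> (apply_bcontfun u)" for u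
    unfolding \<Psi>_def by (intro Bcontfun_inverse \<Phi>_bcontfun[where K = "norm u"] norm_bounded) auto
  have "\<exists>!u. \<Psi> u = u"
  proof (rule banach_fix_type[where c = "1/2"]; (intro allI)?)
    fix u v :: "real \<Rightarrow>\<^sub>C 'a"
    show "dist (\<Psi> u) (\<Psi> v) \<le> 1/2 * dist u v"
    proof (rule dist_bound)
      fix t
      have "norm (apply_bcontfun u s - apply_bcontfun v s) \<le> dist u v" for s
        using dist_bounded[of u s v] by (simp add: dist_norm)
      then have "norm (\<Phi> (apply_bcontfun u) t - \<Phi> (apply_bcontfun v) t) \<le> dist u v / 2"
        by (intro \<Phi>_contraction) auto
      then show "dist (apply_bcontfun (\<Psi> u) t) (apply_bcontfun (\<Psi> v) t) \<le> 1/2 * dist u v"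
        by (simp add: \<Psi> dist_norm)
    qed
  qed auto
  then obtain u where u: "\<Psi> u = u" and uniq: "\<And>v. \<Psi> v = v \<Longrightarrow> v = u"
    by auto
  define x where "x t = w t *\<^sub>R apply_bcontfun u t" for t
  have "apply_bcontfun u t = \<Phi> (apply_bcontfun u) t" for t
    using fun_cong[OF \<Psi>[of u]] unfolding u .
  then have "x t = w t *\<^sub>R \<Phi> (apply_bcontfun u) t" for t
    unfolding x_def by (rule arg_cong)
  also have "w t *\<^sub>R \<Phi> (apply_bcontfun u) t = a + primitive_from_0 (\<lambda>s. G (x s)) t" for t
    using w0[of t] by (simp add: \<Phi>_def x_def)
  finally have x: "x t = a + primitive_from_0 (\<lambda>s. G (x s)) t" for t .
  show ?thesis
  proof (intro exI[of _ x] conjI allI impI)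
    show "x 0 = a" using x[of 0] by simp
    have "continuous_on UNIV (\<lambda>s. G (x s))"
      unfolding x_def by (intro Gwu) auto
    then have "((\<lambda>t. a + primitive_from_0 (\<lambda>s. G (x s)) t) has_vector_derivative 0 + G (x t)) (at t)" for t
      by (intro has_vector_derivative_add has_vector_derivative_const primitive_from_0_has_vector_derivative)
    then show "(x has_vector_derivative G (x t)) (at t)" for t
      unfolding x[symmetric] by simp
  next
    \<comment> \<open>Boundedness of y puts y / w into the space in which the fixed point is unique.
      In the application the bound comes from conservation of the norm.\<close>
    fix y K
    assume "y 0 = a \<and> (\<forall>t. (y has_vector_derivative G (y t)) (at t)) \<and> (\<forall>t. norm (y t) \<le> K)"
    then have y: "y 0 = a" "\<And>t. (y has_vector_derivative G (y t)) (at t)" "\<And>t. norm (y t) \<le> K"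
      by auto
    have yc: "continuous_on UNIV y"
      using y(2) by (rule vector_derivative_imp_continuous_on)
    define v where "v t = inverse (w t) *\<^sub>R y t" for t
    have "v \<in> bcontfun"
    proof (rule bcontfun_normI)
      have "w t \<noteq> 0" for t using w0[of t] by simp
      then show "continuous_on UNIV v"
        unfolding v_def by (intro continuous_intros wc yc) auto
      have "0 \<le> K" using y(3)[of 0] norm_ge_zero order_trans by blast
      then show "norm (v t) \<le> K" for t
        unfolding v_def using mult_left_mono[OF w1[of t], of K] y(3)[of t]
        by (intro scale) simp
    qed
    then have v: "apply_bcontfun (Bcontfun v) = v"
      by (rule Bcontfun_inverse)
    have wv: "w t *\<^sub>R v t = y t" for t
      using w0[of t] by (simp add: v_def)
    have "\<Phi> v = v"
      unfolding \<Phi>_def wv primitive_from_0_eq_diff[OF y(2)] y(1) by (auto simp: v_def)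
    then have "\<Psi> (Bcontfun v) = Bcontfun v"
      unfolding \<Psi>_def v by simp
    then have "Bcontfun v = u" by (rule uniq)
    then show "y = x"
      using v wv by (auto simp: x_def fun_eq_iff)
  qed
qed

section \<open>The radial retraction onto a ball\<close>

definition radial_retraction :: "real \<Rightarrow> 'a::real_normed_vector \<Rightarrow> 'a" where
  "radial_retraction R x = (if norm x \<le> R then x else (R / norm x) *\<^sub>R x)"

lemma norm_radial_retraction_le: "0 \<le> R \<Longrightarrow> norm (radial_retraction R x) \<le> R"
  by (auto simp: radial_retraction_def)

text \<open>The constant 2 comes from the triangle inequality alone. Pulling an outer point x back
  to the sphere moves it by norm x - R, which is at most norm (x - y) when y lies in the
  ball.\<close>

lemma norm_radial_retraction_diff_le:
  fixes x y :: "'a::real_normed_vector"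
  assumes R: "0 < R"
  shows "norm (radial_retraction R x - radial_retraction R y) \<le> 2 * norm (x - y)"
proof -
  have one_inside: "norm ((R / norm x) *\<^sub>R x - y) \<le> 2 * norm (x - y)"
    if "R < norm x" "norm y \<le> R" for x y :: 'a
  proof -
    have "norm ((R / norm x) *\<^sub>R x - x) = norm ((R / norm x - 1) *\<^sub>R x)"
      by (simp add: algebra_simps)
    also have "\<dots> = \<bar>R / norm x - 1\<bar> * norm x"
      by (rule norm_scaleR)
    also have "\<dots> = norm x - R"
      using that R by (cases "x = 0") (auto simp: abs_if field_simps)
    also have "\<dots> \<le> norm (x - y)"
      using that norm_triangle_ineq2[of x y] by simp
    finally show ?thesis
      using norm_triangle_ineq[of "(R / norm x) *\<^sub>R x - x" "x - y"] by simp
  qed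
  have both_outside: "norm ((R / norm x) *\<^sub>R x - (R / norm y) *\<^sub>R y) \<le> 2 * norm (x - y)"
    if "R < norm x" "R < norm y" for x y :: 'a
  proof -
    \<comment> \<open>The difference is split as (R / norm x) (x - y) + (R / norm x - R / norm y) y,
      and each summand has norm at most norm (x - y).\<close>
    have le1: "R / norm x \<le> 1"
      using that R by (intro divide_le_eq_1_pos[THEN iffD2]) linarith+
    have "norm ((R / norm x - R / norm y) *\<^sub>R y) = R / norm x * \<bar>norm x - norm y\<bar>"
    proof -
      have "R / norm x - R / norm y = R / norm x * (norm y - norm x) / norm y"
        using that R by (cases "x = 0"; cases "y = 0") (auto simp: field_simps)
      then show ?thesis
        using that R by (cases "y = 0") (auto simp: abs_mult abs_minus_commute)
    qed
    also have "\<dots> \<le> 1 * norm (x - y)"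
      using le1 by (intro mult_mono norm_triangle_ineq3) auto
    finally have 1: "norm ((R / norm x - R / norm y) *\<^sub>R y) \<le> norm (x - y)" by simp
    have "norm ((R / norm x) *\<^sub>R (x - y)) \<le> 1 * norm (x - y)"
      using le1 R by (simp only: norm_scaleR, intro mult_right_mono) auto
    with 1 norm_triangle_ineq[of "(R / norm x) *\<^sub>R (x - y)" "(R / norm x - R / norm y) *\<^sub>R y"]
    show ?thesis by (simp add: algebra_simps)
  qed
  show ?thesis
    using one_inside[of x y] one_inside[of y x] both_outside[of x y]
    by (auto simp: radial_retraction_def norm_minus_commute)
qed

section \<open>Bounded trilinear maps\<close>

text \<open>With derivatives written as limits of quotients, the product rule for a trilinear map
  reduces to its continuity.\<close>

lemma has_vector_derivative_iff_difference_quotient: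
  "(f has_vector_derivative D) (at x) \<longleftrightarrow> ((\<lambda>y. (f y - f x) /\<^sub>R (y - x)) \<longlongrightarrow> D) (at x)"
proof -
  have "norm ((f y - f x) /\<^sub>R (y - x) - D) = norm ((f y - f x) - (y - x) *\<^sub>R D) / norm (y - x)" if "y \<noteq> x" for y
  proof -
    have "(f y - f x) /\<^sub>R (y - x) - D = ((f y - f x) - (y - x) *\<^sub>R D) /\<^sub>R (y - x)"
      using that by (simp add: scaleR_diff_right)
    then show ?thesis
      by (simp add: divide_inverse mult.commute)
  qed
  then have "((\<lambda>y. norm ((f y - f x) - (y - x) *\<^sub>R D) / norm (y - x)) \<longlongrightarrow> 0) (at x)
      \<longleftrightarrow> ((\<lambda>y. norm ((f y - f x) /\<^sub>R (y - x) - D)) \<longlongrightarrow> 0) (at x)"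
    by (intro Lim_cong_within) auto
  also have "\<dots> \<longleftrightarrow> ((\<lambda>y. (f y - f x) /\<^sub>R (y - x)) \<longlongrightarrow> D) (at x)"
    by (simp only: tendsto_norm_zero_iff Lim_null[symmetric])
  finally show ?thesis
    by (simp add: has_vector_derivative_def has_derivative_iff_norm bounded_linear_scaleR_left)
qed

text \<open>Linearity is over the reals because \<open>conformal_T\<close> is conjugate linear in
  its first argument. The bound K is a parameter since it enters the Lipschitz constant of the cubic
  map.\<close>

locale bounded_trilinear =
  fixes T :: "'a::real_normed_vector \<Rightarrow> 'b::real_normed_vector \<Rightarrow> 'c::real_normed_vector \<Rightarrow> 'd::real_normed_vector"
    and K :: real
  assumes linear_1: "linear (\<lambda>x. T x y z)"
    and linear_2: "linear (\<lambda>y. T x y z)"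
    and linear_3: "linear (\<lambda>z. T x y z)"
    and norm_le: "norm (T x y z) \<le> K * norm x * norm y * norm z"
    and nonneg: "0 \<le> K"
begin

text \<open>The arguments are changed one at a time. Continuity, the product rule and the factor 3
  in \<open>cubic_diff_le\<close> all come from these three terms.\<close>

lemma diff_telescope:
  "T x y z - T x' y' z' = T (x - x') y z + T x' (y - y') z + T x' y' (z - z')"
  using linear_diff[OF linear_1[of y z], of x x'] linear_diff[OF linear_2[of x' z], of y y']
    linear_diff[OF linear_3[of x' y'], of z z']
  by simp

lemma tendsto [tendsto_intros]:
  assumes f: "(f \<longlongrightarrow> x) F" and g: "(g \<longlongrightarrow> y) F" and h: "(h \<longlongrightarrow> z) F"
  shows "((\<lambda>t. T (f t) (g t) (h t)) \<longlongrightarrow> T x y z) F"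
proof -
  have "((\<lambda>t. K * norm (f t - x) * norm (g t) * norm (h t) + K * norm x * norm (g t - y) * norm (h t)
      + K * norm x * norm y * norm (h t - z)) \<longlongrightarrow>
      K * norm (x - x) * norm y * norm z + K * norm x * norm (y - y) * norm z + K * norm x * norm y * norm (z - z)) F"
    by (intro tendsto_intros f g h)
  then have lim: "((\<lambda>t. K * norm (f t - x) * norm (g t) * norm (h t) + K * norm x * norm (g t - y) * norm (h t)
      + K * norm x * norm y * norm (h t - z)) \<longlongrightarrow> 0) F"
    by simp
  have "norm (T (f t) (g t) (h t) - T x y z) \<le> K * norm (f t - x) * norm (g t) * norm (h t)
      + K * norm x * norm (g t - y) * norm (h t) + K * norm x * norm y * norm (h t - z)" for t
    unfolding diff_telescope[of _ _ _ x y z] by (intro norm_triangle_le add_mono norm_le)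
  then have "((\<lambda>t. T (f t) (g t) (h t) - T x y z) \<longlongrightarrow> 0) F"
    by (intro Lim_null_comparison[OF _ lim] always_eventually allI)
  then show ?thesis
    by (rule Lim_null[THEN iffD2])
qed

lemma has_vector_derivative:
  assumes f: "(f has_vector_derivative f') (at t)" and g: "(g has_vector_derivative g') (at t)"
    and h: "(h has_vector_derivative h') (at t)"
  shows "((\<lambda>t. T (f t) (g t) (h t)) has_vector_derivative
      T f' (g t) (h t) + T (f t) g' (h t) + T (f t) (g t) h') (at t)"
proof -
  \<comment> \<open>In the telescoped quotient the slots to the right of the varied one are still
    evaluated at s, which is where continuity of g and h enters.\<close>
  have "((\<lambda>s. T ((f s - f t) /\<^sub>R (s - t)) (g s) (h s) + T (f t) ((g s - g t) /\<^sub>R (s - t)) (h s)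
      + T (f t) (g t) ((h s - h t) /\<^sub>R (s - t)))
      \<longlongrightarrow> T f' (g t) (h t) + T (f t) g' (h t) + T (f t) (g t) h') (at t)"
    using f g h has_vector_derivative_continuous[OF g] has_vector_derivative_continuous[OF h]
    by (intro tendsto_add tendsto tendsto_const)
      (simp_all only: has_vector_derivative_iff_difference_quotient isCont_def)
  moreover have "T (r *\<^sub>R x) y z = r *\<^sub>R T x y z" "T x (r *\<^sub>R y) z = r *\<^sub>R T x y z"
    "T x y (r *\<^sub>R z) = r *\<^sub>R T x y z" for r x y z
    using linear_scale[OF linear_1] linear_scale[OF linear_2] linear_scale[OF linear_3] by auto
  ultimately show ?thesis
    unfolding has_vector_derivative_iff_difference_quotient diff_telescope by (simp add: scaleR_add_right)
qed

end

lemma cubic_diff_le: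
  assumes "bounded_trilinear T K" and "norm x \<le> R" "norm y \<le> R"
  shows "norm (T x x x - T y y y) \<le> 3 * K * R\<^sup>2 * norm (x - y)"
proof -
  interpret bounded_trilinear T K by fact
  have R: "0 \<le> R" using assms(2) norm_ge_zero order_trans by blast
  have "norm (T (x - y) x x) \<le> K * norm (x - y) * R * R"
    using assms R nonneg by (intro order_trans[OF norm_le] mult_mono) auto
  moreover have "norm (T y (x - y) x) \<le> K * R * norm (x - y) * R"
    using assms R nonneg by (intro order_trans[OF norm_le] mult_mono) auto
  moreover have "norm (T y y (x - y)) \<le> K * R * R * norm (x - y)"
    using assms R nonneg by (intro order_trans[OF norm_le] mult_mono) auto
  ultimately have "norm (T x x x - T y y y)
      \<le> K * norm (x - y) * R * R + K * R * norm (x - y) * R + K * R * R * norm (x - y)"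
    unfolding diff_telescope[of x x x] by (intro norm_triangle_le add_mono)
  then show ?thesis
    by (simp add: power2_eq_square algebra_simps)
qed

section \<open>Completeness of the sequence space\<close>

lemma L2_set_weighted_le_hs_norm:
  assumes "f \<in> hs 1"
  shows "L2_set (\<lambda>n. (real n + 1) * norm (f n)) {..<N} \<le> hs_norm 1 f"
proof (rule LIMSEQ_le_const)
  show "(\<lambda>N. L2_set (\<lambda>n. (real n + 1) * norm (f n)) {..<N}) \<longlonglongrightarrow> hs_norm 1 f"
    using hs_norm_LIMSEQ[OF assms] by simp
  show "\<exists>M. \<forall>n\<ge>M. L2_set (\<lambda>n. (real n + 1) * norm (f n)) {..<N}
      \<le> L2_set (\<lambda>n. (real n + 1) * norm (f n)) {..<n}"
    by (auto simp: L2_set_def intro!: exI[of _ N] sum_mono2)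
qed

text \<open>Uniform bounds on finite sections yield membership and the norm bound at once;
  completeness and the boundedness of the nonlinearity are both proved in this form.\<close>

lemma hs_1I:
  assumes K: "\<And>N. L2_set (\<lambda>n. (real n + 1) * norm (f n)) {..<N} \<le> K"
  shows "f \<in> hs 1" and "hs_norm 1 f \<le> K"
proof -
  have "(\<Sum>n<N. ((real n + 1) * norm (f n))\<^sup>2) \<le> K\<^sup>2" for N
    using K[of N] unfolding L2_set_def by (rule sqrt_le_D)
  then have w: "summable (\<lambda>n. ((real n + 1) * norm (f n))\<^sup>2)"
    by (intro summableI_nonneg_bounded) auto
  have "summable (\<lambda>n. (norm (f n))\<^sup>2)"
    by (rule summable_comparison_test'[OF w]) (auto intro!: power_mono simp: mult_le_cancel_right1)
  then show f: "f \<in> hs 1"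
    using w by (simp add: hs_def power_mult_distrib)
  show "hs_norm 1 f \<le> K"
    using hs_norm_LIMSEQ[OF f] K by (intro LIMSEQ_le_const2) auto
qed

lemma hs_norm_nonneg: "f \<in> hs s \<Longrightarrow> 0 \<le> hs_norm s f"
  unfolding hs_norm_def hs_def by (auto intro!: suminf_nonneg)

lemma weighted_coeff_le_hs_norm:
  assumes "f \<in> hs 1"
  shows "(real n + 1) * norm (f n) \<le> hs_norm 1 f"
  using member_le_L2_set[of "{..<Suc n}" n "\<lambda>n. (real n + 1) * norm (f n)"]
    L2_set_weighted_le_hs_norm[OF assms, of "Suc n"] by simp

lemma coeff_le_hs_norm:
  assumes "f \<in> hs 1"
  shows "norm (f n) \<le> hs_norm 1 f"
  using weighted_coeff_le_hs_norm[OF assms, of n] mult_right_mono[of 1 "real n + 1" "norm (f n)"]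
  by simp

section \<open>Cauchy-Schwarz and the embedding of h1 into l1\<close>

lemma Cauchy_Schwarz_suminf:
  fixes f g :: "nat \<Rightarrow> real"
  assumes f0: "\<And>n. 0 \<le> f n" and g0: "\<And>n. 0 \<le> g n"
    and f: "\<And>N. L2_set f {..<N} \<le> A" and g: "\<And>N. L2_set g {..<N} \<le> B"
  shows "summable (\<lambda>n. f n * g n)" and "(\<Sum>n. f n * g n) \<le> A * B"
proof -
  have "0 \<le> A" "0 \<le> B" using f[of 0] g[of 0] by auto
  have le: "(\<Sum>n<N. f n * g n) \<le> A * B" for N
  proof -
    have "(\<Sum>n<N. f n * g n) \<le> L2_set f {..<N} * L2_set g {..<N}"
      using L2_set_mult_ineq[of f g "{..<N}"] f0 g0 by simp
    also have "\<dots> \<le> A * B"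
      using \<open>0 \<le> A\<close> by (intro mult_mono f g) auto
    finally show ?thesis .
  qed
  show s: "summable (\<lambda>n. f n * g n)"
    using f0 g0 le by (intro summableI_nonneg_bounded) auto
  show "(\<Sum>n. f n * g n) \<le> A * B"
    by (rule suminf_le_const[OF s le])
qed

text \<open>The l2 norm of the sequence 1 / (n + 1). By Cauchy-Schwarz against the weighted
  coefficients it bounds the embedding of h1 into l1.\<close>

definition l1_embedding_const :: real where
  "l1_embedding_const = sqrt (\<Sum>n. inverse (real (Suc n) ^ 2))"

lemma summable_inverse_Suc_squares: "summable (\<lambda>n. inverse (real (Suc n) ^ 2))"
  using inverse_power_summable[of 2, where 'a = real] by (subst summable_Suc_iff) auto

lemma l1_embedding_const_nonneg: "0 \<le> l1_embedding_const"
  unfolding l1_embedding_const_def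
  by (intro real_sqrt_ge_zero suminf_nonneg summable_inverse_Suc_squares) auto

lemma suminf_norm_le_hs_norm:
  assumes "f \<in> hs 1"
  shows "(\<Sum>n. norm (f n)) \<le> l1_embedding_const * hs_norm 1 f"
proof -
  have "L2_set (\<lambda>n. inverse (real n + 1)) {..<N} \<le> l1_embedding_const" for N
    unfolding L2_set_def l1_embedding_const_def
    using sum_le_suminf[OF summable_inverse_Suc_squares, of "{..<N}"] by (simp add: power_inverse add.commute)
  then have "(\<Sum>n. inverse (real n + 1) * ((real n + 1) * norm (f n))) \<le> l1_embedding_const * hs_norm 1 f"
    by (intro Cauchy_Schwarz_suminf L2_set_weighted_le_hs_norm assms) auto
  moreover have "inverse (real n + 1) * ((real n + 1) * norm (f n)) = norm (f n)" for n
    by (simp add: field_simps)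
  ultimately show ?thesis by simp
qed

lemmas h1_coeff_simps [simp] =
  zero_h1.rep_eq plus_h1.rep_eq minus_h1.rep_eq uminus_h1.rep_eq scaleR_h1.rep_eq h1_scaleC.rep_eq

lemma h1_eqI: "(\<And>n. h1_coeff x n = h1_coeff y n) \<Longrightarrow> x = y"
  by (simp add: h1_coeff_inject[symmetric] fun_eq_iff)

lemma norm_h1_coeff_le: "norm (h1_coeff x n) \<le> norm x"
  unfolding norm_h1.rep_eq by (rule coeff_le_hs_norm[OF h1_coeff])

text \<open>The norm dominates each coefficient, so a Cauchy sequence converges coefficientwise. On
  a finite section the Cauchy estimate passes to this limit, and \<open>hs_1I\<close> then removes
  the truncation.\<close>

instance h1 :: banach
proof
  fix X :: "nat \<Rightarrow> h1"
  assume X: "Cauchy X"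
  have "Cauchy (\<lambda>i. h1_coeff (X i) n)" for n
  proof (rule metric_CauchyI)
    fix e :: real assume "0 < e"
    obtain M where M: "\<And>i j. i \<ge> M \<Longrightarrow> j \<ge> M \<Longrightarrow> dist (X i) (X j) < e"
      using metric_CauchyD[OF X \<open>0 < e\<close>] by blast
    have "dist (h1_coeff (X i) n) (h1_coeff (X j) n) \<le> dist (X i) (X j)" for i j
      using norm_h1_coeff_le[of "X i - X j" n] by (simp add: dist_norm)
    then show "\<exists>M. \<forall>i\<ge>M. \<forall>j\<ge>M. dist (h1_coeff (X i) n) (h1_coeff (X j) n) < e"
      using M by (meson le_less_trans)
  qed
  then have "\<forall>n. \<exists>l. (\<lambda>i. h1_coeff (X i) n) \<longlonglongrightarrow> l"
    by (simp add: Cauchy_convergent_iff convergent_def)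
  from choice[OF this] obtain a where a: "\<forall>n. (\<lambda>i. h1_coeff (X i) n) \<longlonglongrightarrow> a n" ..
  have limit: "\<exists>M. \<forall>i\<ge>M. (\<lambda>n. h1_coeff (X i) n - a n) \<in> hs 1 \<and> hs_norm 1 (\<lambda>n. h1_coeff (X i) n - a n) \<le> e"
    if e: "0 < e" for e
  proof -
    obtain M where M: "\<And>i j. i \<ge> M \<Longrightarrow> j \<ge> M \<Longrightarrow> dist (X i) (X j) < e"
      using metric_CauchyD[OF X e] by blast
    have "L2_set (\<lambda>n. (real n + 1) * norm (h1_coeff (X i) n - a n)) {..<N} \<le> e" if "i \<ge> M" for i N
    proof (rule LIMSEQ_le_const2)
      show "(\<lambda>j. L2_set (\<lambda>n. (real n + 1) * norm (h1_coeff (X i) n - h1_coeff (X j) n)) {..<N})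
          \<longlonglongrightarrow> L2_set (\<lambda>n. (real n + 1) * norm (h1_coeff (X i) n - a n)) {..<N}"
        unfolding L2_set_def by (intro tendsto_intros a[rule_format])
      have "L2_set (\<lambda>n. (real n + 1) * norm (h1_coeff (X i) n - h1_coeff (X j) n)) {..<N} \<le> e"
        if "j \<ge> M" for j
      proof -
        have "L2_set (\<lambda>n. (real n + 1) * norm (h1_coeff (X i - X j) n)) {..<N} \<le> norm (X i - X j)"
          unfolding norm_h1.rep_eq by (rule L2_set_weighted_le_hs_norm[OF h1_coeff])
        then show ?thesis
          using M[OF \<open>i \<ge> M\<close> that] by (simp add: dist_norm)
      qed
      then show "\<exists>M. \<forall>j\<ge>M. L2_set (\<lambda>n. (real n + 1) * norm (h1_coeff (X i) n - h1_coeff (X j) n)) {..<N} \<le> e"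
        by blast
    qed
    then show ?thesis
      by (intro exI[of _ M] allI impI conjI hs_1I)
  qed
  \<comment> \<open>The limit lies in the space because a = X M - (X M - a), a difference of two
    members.\<close>
  obtain M where "(\<lambda>n. h1_coeff (X M) n - a n) \<in> hs 1"
    using limit[of 1] by auto
  from hs_diff[OF h1_coeff this, of "X M"] have "a \<in> hs 1"
    by simp
  then have A: "h1_coeff (Abs_h1 a) = a"
    by (rule Abs_h1_inverse)
  have "X \<longlonglongrightarrow> Abs_h1 a"
  proof (rule LIMSEQ_I)
    fix r :: real assume "0 < r"
    then have "0 < r / 2" by simp
    have n: "norm (X i - Abs_h1 a) = hs_norm 1 (\<lambda>n. h1_coeff (X i) n - a n)" for i
      by (simp add: norm_h1.rep_eq A)
    obtain M where "\<forall>i\<ge>M. norm (X i - Abs_h1 a) \<le> r / 2"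
      using limit[OF \<open>0 < r / 2\<close>] unfolding n by blast
    then show "\<exists>M. \<forall>i\<ge>M. norm (X i - Abs_h1 a) < r"
      using \<open>0 < r\<close> by (intro exI[of _ M]) force
  qed
  then show "convergent X"
    by (rule convergentI)
qed

lemma norm_h1_scaleC_le: "norm (h1_scaleC c x) \<le> norm c * norm x"
  unfolding norm_h1.rep_eq
proof (rule hs_1I(2))
  fix N
  have "L2_set (\<lambda>n. (real n + 1) * norm (h1_coeff (h1_scaleC c x) n)) {..<N}
      = norm c * L2_set (\<lambda>n. (real n + 1) * norm (h1_coeff x n)) {..<N}"
    by (subst L2_set_right_distrib) (simp_all add: norm_mult mult_ac)
  also have "\<dots> \<le> norm c * hs_norm 1 (h1_coeff x)"
    by (intro mult_left_mono L2_set_weighted_le_hs_norm h1_coeff) auto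
  finally show "L2_set (\<lambda>n. (real n + 1) * norm (h1_coeff (h1_scaleC c x) n)) {..<N}
      \<le> norm c * hs_norm 1 (h1_coeff x)" .
qed

lemma bounded_linear_h1_scaleC: "bounded_linear (h1_scaleC c)"
proof (rule bounded_linear_intro)
  show "norm (h1_scaleC c x) \<le> norm x * norm c" for x
    using norm_h1_scaleC_le[of c x] by (simp only: mult.commute)
qed (auto simp: h1_coeff_inject[symmetric] fun_eq_iff algebra_simps)

section \<open>Boundedness of the nonlinearity\<close>

text \<open>Writing c = sqrt c * sqrt c and applying Cauchy-Schwarz over the rectangle of indices
  leaves, for fixed n or fixed j, a sum of c (n + j) in the other index, which is at most the l1
  norm of c.\<close>

lemma hankel_form_bound:
  fixes x y c :: "nat \<Rightarrow> real"
  assumes c: "summable c" and c0: "\<And>m. 0 \<le> c m" and x0: "\<And>n. 0 \<le> x n" and y0: "\<And>n. 0 \<le> y n"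
  shows "(\<Sum>n<N. \<Sum>j<J. x n * y j * c (n + j)) \<le> L2_set x {..<N} * L2_set y {..<J} * suminf c"
proof -
  have C: "(\<Sum>i<N. c (m + i)) \<le> suminf c" for m N
  proof -
    have "(\<Sum>i<N. c (m + i)) = sum c ((+) m ` {..<N})"
      by (subst sum.reindex) auto
    also have "\<dots> \<le> suminf c"
      by (rule sum_le_suminf[OF c]) (auto simp: c0)
    finally show ?thesis .
  qed
  have C0: "0 \<le> suminf c"
    using c c0 by (rule suminf_nonneg)
  have bound: "L2_set (\<lambda>(n, j). x n * sqrt (c (n + j))) ({..<N} \<times> {..<J}) \<le> L2_set x {..<N} * sqrt (suminf c)"
    for x :: "nat \<Rightarrow> real" and N J
  proof -
    have "(\<Sum>(n, j)\<in>{..<N} \<times> {..<J}. (x n * sqrt (c (n + j)))\<^sup>2) = (\<Sum>n<N. (x n)\<^sup>2 * (\<Sum>j<J. c (n + j)))"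
      by (simp add: sum.cartesian_product[symmetric] power_mult_distrib c0 sum_distrib_left)
    also have "\<dots> \<le> (\<Sum>n<N. (x n)\<^sup>2 * suminf c)"
      by (intro sum_mono mult_left_mono C) auto
    finally show ?thesis
      unfolding L2_set_def real_sqrt_mult[symmetric]
      by (simp add: sum_distrib_right case_prod_unfold)
  qed
  \<comment> \<open>Since c sees only n + j, transposing the rectangle turns the second factor into
    an instance of \<open>bound\<close>.\<close>
  have swap: "L2_set (\<lambda>(n, j). y j * sqrt (c (n + j))) ({..<N} \<times> {..<J})
      = L2_set (\<lambda>(n, j). y n * sqrt (c (n + j))) ({..<J} \<times> {..<N})"
    unfolding L2_set_def
    by (rule arg_cong[of _ _ sqrt], rule sum.reindex_bij_witness[of _ prod.swap prod.swap])
      (auto simp: add.commute)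
  have "(\<Sum>n<N. \<Sum>j<J. x n * y j * c (n + j))
      = (\<Sum>p\<in>{..<N} \<times> {..<J}. \<bar>case p of (n, j) \<Rightarrow> x n * sqrt (c (n + j))\<bar>
                         * \<bar>case p of (n, j) \<Rightarrow> y j * sqrt (c (n + j))\<bar>)"
    unfolding sum.cartesian_product
    by (intro sum.cong refl) (auto simp: abs_mult x0 y0 c0 abs_of_nonneg)
  also have "\<dots> \<le> L2_set (\<lambda>(n, j). x n * sqrt (c (n + j))) ({..<N} \<times> {..<J})
      * L2_set (\<lambda>(n, j). y j * sqrt (c (n + j))) ({..<N} \<times> {..<J})"
    by (rule L2_set_mult_ineq)
  also have "\<dots> \<le> (L2_set x {..<N} * sqrt (suminf c)) * (L2_set y {..<J} * sqrt (suminf c))"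
    unfolding swap by (intro mult_mono bound) (auto simp: C0)
  also have "\<dots> = L2_set x {..<N} * L2_set y {..<J} * suminf c"
    using C0 by (simp add: algebra_simps)
  finally show ?thesis .
qed

section \<open>The polarised nonlinearity and its h1 bound\<close>

definition norm_convolution :: "(nat \<Rightarrow> complex) \<Rightarrow> (nat \<Rightarrow> complex) \<Rightarrow> nat \<Rightarrow> real" where
  "norm_convolution b c m = (\<Sum>k\<le>m. norm (b k) * norm (c (m - k)))"

lemma norm_convolution_nonneg: "0 \<le> norm_convolution b c m"
  by (auto simp: norm_convolution_def intro!: sum_nonneg)

lemma norm_convolution_sums:
  assumes "b \<in> hs 1" "c \<in> hs 1"
  shows "norm_convolution b c sums ((\<Sum>n. norm (b n)) * (\<Sum>n. norm (c n)))"
  using Cauchy_product_sums[of "\<lambda>n. norm (b n)" "\<lambda>n. norm (c n)"]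
    h1_summable_norm[OF assms(1)] h1_summable_norm[OF assms(2)]
  unfolding norm_convolution_def[abs_def] by simp

lemmas summable_norm_convolution = sums_summable[OF norm_convolution_sums]

lemma suminf_norm_convolution_le:
  assumes "b \<in> hs 1" "c \<in> hs 1"
  shows "suminf (norm_convolution b c) \<le> l1_embedding_const\<^sup>2 * hs_norm 1 b * hs_norm 1 c"
proof -
  have "suminf (norm_convolution b c) = (\<Sum>n. norm (b n)) * (\<Sum>n. norm (c n))"
    using norm_convolution_sums[OF assms] by (simp add: sums_iff)
  also have "\<dots> \<le> (l1_embedding_const * hs_norm 1 b) * (l1_embedding_const * hs_norm 1 c)"
    using assms by (intro mult_mono suminf_norm_le_hs_norm suminf_nonneg h1_summable_norm mult_nonneg_nonneg
        l1_embedding_const_nonneg hs_norm_nonneg) auto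
  finally show ?thesis
    by (simp add: power2_eq_square mult_ac)
qed

text \<open>The j-th summand of \<open>conformal_F_seq\<close>, polarised: the three occurrences of
  the sequence become independent arguments.\<close>

definition conformal_T_term ::
  "(nat \<Rightarrow> complex) \<Rightarrow> (nat \<Rightarrow> complex) \<Rightarrow> (nat \<Rightarrow> complex) \<Rightarrow> nat \<Rightarrow> nat \<Rightarrow> complex" where
  "conformal_T_term a b c n j =
    (\<Sum>k = 0..n + j. of_nat (conformal_S n j k) / of_nat (n + 1) * (cnj (a j) * b k * c (n + j - k)))"

definition conformal_T_seq ::
  "(nat \<Rightarrow> complex) \<Rightarrow> (nat \<Rightarrow> complex) \<Rightarrow> (nat \<Rightarrow> complex) \<Rightarrow> nat \<Rightarrow> complex" where
  "conformal_T_seq a b c n = (\<Sum>j. conformal_T_term a b c n j)"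

text \<open>The estimate S \<le> j + 1 puts the whole weight on a, so b and c enter only through
  their l1 convolution. The remaining 1 / (n + 1) cancels the weight of the h1 norm.\<close>

lemma norm_conformal_T_term_le:
  "norm (conformal_T_term a b c n j) \<le> ((real j + 1) * norm (a j)) * norm_convolution b c (n + j) / (real n + 1)"
proof -
  have S: "real (conformal_S n j k) \<le> real j + 1" for k
    by (simp add: conformal_S_def)
  have "norm (conformal_T_term a b c n j)
    \<le> (\<Sum>k = 0..n + j. norm (of_nat (conformal_S n j k) / of_nat (n + 1) * (cnj (a j) * b k * c (n + j - k))))"
    unfolding conformal_T_term_def by (rule norm_sum)
  also have "\<dots> = (\<Sum>k = 0..n + j. real (conformal_S n j k) / (real n + 1) * (norm (a j) * norm (b k) * norm (c (n + j - k))))"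
    by (intro sum.cong refl, simp only: norm_mult norm_divide norm_of_nat complex_mod_cnj)
      (simp add: add.commute)
  also have "\<dots> \<le> (\<Sum>k = 0..n + j. (real j + 1) / (real n + 1) * (norm (a j) * norm (b k) * norm (c (n + j - k))))"
    by (intro sum_mono mult_right_mono divide_right_mono S) auto
  also have "\<dots> = ((real j + 1) * norm (a j)) * norm_convolution b c (n + j) / (real n + 1)"
    by (simp add: norm_convolution_def sum_distrib_left sum_distrib_right sum_divide_distrib atLeast0AtMost mult_ac)
  finally show ?thesis .
qed

lemma summable_hankel:
  assumes "a \<in> hs 1" "b \<in> hs 1" "c \<in> hs 1"
  shows "summable (\<lambda>j. ((real j + 1) * norm (a j)) * norm_convolution b c (n + j))"
proof (rule summable_comparison_test')
  have "summable (\<lambda>j. norm_convolution b c (n + j))"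
    using summable_iff_shift[of "norm_convolution b c" n] summable_norm_convolution[OF assms(2,3)]
    by (simp add: add.commute)
  then show "summable (\<lambda>j. hs_norm 1 a * norm_convolution b c (n + j))"
    by (rule summable_mult)
  show "norm (((real j + 1) * norm (a j)) * norm_convolution b c (n + j)) \<le> hs_norm 1 a * norm_convolution b c (n + j)" for j :: nat
    using mult_right_mono[OF weighted_coeff_le_hs_norm[OF assms(1)] norm_convolution_nonneg[of b c "n + j"], of j]
      norm_convolution_nonneg[of b c "n + j"]
    by (simp add: abs_mult)
qed

lemma summable_norm_conformal_T_term:
  assumes "a \<in> hs 1" "b \<in> hs 1" "c \<in> hs 1"
  shows "summable (\<lambda>j. norm (conformal_T_term a b c n j))"
  by (rule summable_comparison_test'[OF summable_divide[OF summable_hankel[OF assms]]])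
    (use norm_conformal_T_term_le in simp)

lemmas summable_conformal_T_term = summable_norm_cancel[OF summable_norm_conformal_T_term]

lemma weighted_norm_conformal_T_seq_le:
  assumes "a \<in> hs 1" "b \<in> hs 1" "c \<in> hs 1"
  shows "(real n + 1) * norm (conformal_T_seq a b c n)
    \<le> (\<Sum>j. ((real j + 1) * norm (a j)) * norm_convolution b c (n + j))"
proof -
  have "norm (conformal_T_seq a b c n) \<le> (\<Sum>j. norm (conformal_T_term a b c n j))"
    unfolding conformal_T_seq_def by (rule summable_norm[OF summable_norm_conformal_T_term[OF assms]])
  also have "\<dots> \<le> (\<Sum>j. ((real j + 1) * norm (a j)) * norm_convolution b c (n + j) / (real n + 1))"
    by (intro suminf_le norm_conformal_T_term_le summable_norm_conformal_T_term summable_divide summable_hankel assms)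
  also have "\<dots> = (\<Sum>j. ((real j + 1) * norm (a j)) * norm_convolution b c (n + j)) / (real n + 1)"
    by (rule suminf_divide[OF summable_hankel[OF assms]])
  finally show ?thesis by (simp add: field_simps)
qed

text \<open>A duality argument: the truncated weighted sequence is paired with itself, one factor is
  replaced by its Hankel majorant, and \<open>hankel_form_bound\<close> returns one power of the
  truncated norm, which is then cancelled.\<close>

lemma conformal_T_seq_bound:
  assumes "a \<in> hs 1" "b \<in> hs 1" "c \<in> hs 1"
  shows "L2_set (\<lambda>n. (real n + 1) * norm (conformal_T_seq a b c n)) {..<N}
    \<le> l1_embedding_const\<^sup>2 * hs_norm 1 a * hs_norm 1 b * hs_norm 1 c" (is "L2_set ?X _ \<le> ?A")
proof -
  define y where "y j = (real j + 1) * norm (a j)" for j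
  define C where "C = norm_convolution b c"
  have C: "summable C" and C0: "0 \<le> C m" for m
    unfolding C_def by (rule summable_norm_convolution[OF assms(2,3)], rule norm_convolution_nonneg)
  have A0: "0 \<le> ?A"
    by (intro mult_nonneg_nonneg hs_norm_nonneg assms) auto
  have "(L2_set ?X {..<N})\<^sup>2 = (\<Sum>n<N. ?X n * ?X n)"
    unfolding L2_set_def by (subst real_sqrt_pow2) (auto simp: power2_eq_square intro!: sum_nonneg)
  also have "\<dots> \<le> (\<Sum>n<N. ?X n * (\<Sum>j. y j * C (n + j)))"
    unfolding y_def C_def by (intro sum_mono mult_left_mono weighted_norm_conformal_T_seq_le assms) auto
  also have "\<dots> \<le> L2_set ?X {..<N} * ?A"
  \<comment> \<open>The Hankel bound is for finite rectangles; N stays fixed while J tends to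
    infinity.\<close>
  proof (rule LIMSEQ_le_const2)
    have "(\<lambda>J. \<Sum>n<N. ?X n * (\<Sum>j<J. y j * C (n + j))) \<longlonglongrightarrow> (\<Sum>n<N. ?X n * (\<Sum>j. y j * C (n + j)))"
      unfolding y_def C_def by (intro tendsto_intros summable_LIMSEQ summable_hankel assms)
    then show "(\<lambda>J. \<Sum>n<N. \<Sum>j<J. ?X n * y j * C (n + j)) \<longlonglongrightarrow> (\<Sum>n<N. ?X n * (\<Sum>j. y j * C (n + j)))"
      by (simp add: sum_distrib_left mult.assoc)
    have "(\<Sum>n<N. \<Sum>j<J. ?X n * y j * C (n + j)) \<le> L2_set ?X {..<N} * ?A" for J
    proof -
      have "(\<Sum>n<N. \<Sum>j<J. ?X n * y j * C (n + j)) \<le> L2_set ?X {..<N} * L2_set y {..<J} * suminf C"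
        by (intro hankel_form_bound C C0) (auto simp: y_def)
      also have "\<dots> \<le> L2_set ?X {..<N} * hs_norm 1 a * (l1_embedding_const\<^sup>2 * hs_norm 1 b * hs_norm 1 c)"
        unfolding y_def C_def
        by (intro mult_mono L2_set_weighted_le_hs_norm suminf_norm_convolution_le assms
            suminf_nonneg summable_norm_convolution norm_convolution_nonneg mult_nonneg_nonneg hs_norm_nonneg) auto
      finally show ?thesis by (simp add: mult_ac)
    qed
    then show "\<exists>M. \<forall>J\<ge>M. (\<Sum>n<N. \<Sum>j<J. ?X n * y j * C (n + j)) \<le> L2_set ?X {..<N} * ?A"
      by blast
  qed
  finally have "L2_set ?X {..<N} * L2_set ?X {..<N} \<le> L2_set ?X {..<N} * ?A"
    by (simp add: power2_eq_square)
  \<comment> \<open>Cancelling requires a nonzero truncated norm; if it vanishes, \<open>A0\<close>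
    gives the claim.\<close>
  then show ?thesis
    using A0 by (cases "L2_set ?X {..<N} = 0") (auto simp: mult_le_cancel_left order_less_le)
qed

lift_definition conformal_T :: "h1 \<Rightarrow> h1 \<Rightarrow> h1 \<Rightarrow> h1" is conformal_T_seq
  by (rule hs_1I(1)[OF conformal_T_seq_bound])

lemma conformal_F_eq_T: "conformal_F x = conformal_T x x x"
  by transfer (simp add: conformal_F_seq_def conformal_T_seq_def conformal_T_term_def fun_eq_iff)

lemma conformal_T_coeff:
  "h1_coeff (conformal_T x y z) n = (\<Sum>j. conformal_T_term (h1_coeff x) (h1_coeff y) (h1_coeff z) n j)"
  by (simp add: conformal_T.rep_eq conformal_T_seq_def)

lemma bounded_trilinear_conformal_T: "bounded_trilinear conformal_T (l1_embedding_const\<^sup>2)"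
proof
  note s = summable_conformal_T_term[OF h1_coeff h1_coeff h1_coeff]
  fix x y z :: h1
  show "norm (conformal_T x y z) \<le> l1_embedding_const\<^sup>2 * norm x * norm y * norm z"
    by transfer (rule hs_1I(2)[OF conformal_T_seq_bound])
  fix x' :: h1 and r :: real
  show "conformal_T (x + x') y z = conformal_T x y z + conformal_T x' y z"
    by (rule h1_eqI, unfold plus_h1.rep_eq conformal_T_coeff, subst suminf_add[OF s s])
      (simp add: conformal_T_term_def[abs_def] algebra_simps add_divide_distrib sum.distrib)
  show "conformal_T y (x + x') z = conformal_T y x z + conformal_T y x' z"
    by (rule h1_eqI, unfold plus_h1.rep_eq conformal_T_coeff, subst suminf_add[OF s s])
      (simp add: conformal_T_term_def[abs_def] algebra_simps add_divide_distrib sum.distrib)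
  show "conformal_T y z (x + x') = conformal_T y z x + conformal_T y z x'"
    by (rule h1_eqI, unfold plus_h1.rep_eq conformal_T_coeff, subst suminf_add[OF s s])
      (simp add: conformal_T_term_def[abs_def] algebra_simps add_divide_distrib sum.distrib)
  show "conformal_T (r *\<^sub>R x) y z = r *\<^sub>R conformal_T x y z"
    by (rule h1_eqI, unfold scaleR_h1.rep_eq conformal_T_coeff, subst suminf_scaleR_right[OF s])
      (simp add: conformal_T_term_def[abs_def] scaleR_conv_of_real sum_distrib_left mult_ac)
  show "conformal_T y (r *\<^sub>R x) z = r *\<^sub>R conformal_T y x z"
    by (rule h1_eqI, unfold scaleR_h1.rep_eq conformal_T_coeff, subst suminf_scaleR_right[OF s])
      (simp add: conformal_T_term_def[abs_def] scaleR_conv_of_real sum_distrib_left mult_ac)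
  show "conformal_T y z (r *\<^sub>R x) = r *\<^sub>R conformal_T y z x"
    by (rule h1_eqI, unfold scaleR_h1.rep_eq conformal_T_coeff, subst suminf_scaleR_right[OF s])
      (simp add: conformal_T_term_def[abs_def] scaleR_conv_of_real sum_distrib_left mult_ac)
qed simp

section \<open>Weighted pairings and the quartic form\<close>

text \<open>Exponent 1 serves Q and H, exponent 2 serves E and is the inner product of h1. For p
  \<le> 2 the series converges absolutely on h1.\<close>

definition h1_pairing :: "nat \<Rightarrow> h1 \<Rightarrow> h1 \<Rightarrow> complex" where
  "h1_pairing p x y = (\<Sum>n. of_real ((real n + 1) ^ p) * (cnj (h1_coeff x n) * h1_coeff y n))"

lemma norm_h1_pairing_term_le:
  assumes "p \<le> 2"
  shows "norm (complex_of_real ((real n + 1) ^ p) * (cnj (h1_coeff x n) * h1_coeff y n))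
    \<le> ((real n + 1) * norm (h1_coeff x n)) * ((real n + 1) * norm (h1_coeff y n))"
proof -
  have "(real n + 1) ^ p \<le> (real n + 1)\<^sup>2"
    using assms by (intro power_increasing) auto
  then have "(real n + 1) ^ p * (norm (h1_coeff x n) * norm (h1_coeff y n))
      \<le> (real n + 1)\<^sup>2 * (norm (h1_coeff x n) * norm (h1_coeff y n))"
    by (intro mult_right_mono) auto
  then show ?thesis
    by (simp only: norm_mult norm_of_real complex_mod_cnj) (simp add: power2_eq_square mult_ac)
qed

lemma summable_norm_h1_pairing_term:
  assumes "p \<le> 2"
  shows "summable (\<lambda>n. norm (complex_of_real ((real n + 1) ^ p) * (cnj (h1_coeff x n) * h1_coeff y n)))"
  by (rule summable_comparison_test'[OF Cauchy_Schwarz_suminf(1)[OF _ _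
      L2_set_weighted_le_hs_norm[OF h1_coeff] L2_set_weighted_le_hs_norm[OF h1_coeff]]])
    (use norm_h1_pairing_term_le[OF assms] in auto)

lemmas summable_h1_pairing_term = summable_norm_cancel[OF summable_norm_h1_pairing_term]

lemma norm_h1_pairing_le:
  assumes "p \<le> 2"
  shows "norm (h1_pairing p x y) \<le> norm x * norm y"
proof -
  have "norm (h1_pairing p x y) \<le> (\<Sum>n. norm (complex_of_real ((real n + 1) ^ p) * (cnj (h1_coeff x n) * h1_coeff y n)))"
    unfolding h1_pairing_def by (rule summable_norm[OF summable_norm_h1_pairing_term[OF assms]])
  also have "\<dots> \<le> (\<Sum>n. ((real n + 1) * norm (h1_coeff x n)) * ((real n + 1) * norm (h1_coeff y n)))"
    by (intro suminf_le norm_h1_pairing_term_le summable_norm_h1_pairing_term assms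
        Cauchy_Schwarz_suminf(1)[OF _ _ L2_set_weighted_le_hs_norm[OF h1_coeff] L2_set_weighted_le_hs_norm[OF h1_coeff]]) auto
  also have "\<dots> \<le> norm x * norm y"
    unfolding norm_h1.rep_eq
    by (intro Cauchy_Schwarz_suminf(2) L2_set_weighted_le_hs_norm h1_coeff) auto
  finally show ?thesis .
qed

lemma bounded_bilinear_h1_pairing:
  assumes "p \<le> 2"
  shows "bounded_bilinear (h1_pairing p)"
proof
  note s = summable_h1_pairing_term[OF assms]
  fix x x' y :: h1 and r :: real
  show "h1_pairing p (x + x') y = h1_pairing p x y + h1_pairing p x' y"
    unfolding h1_pairing_def by (subst suminf_add[OF s s]) (simp add: algebra_simps)
  show "h1_pairing p y (x + x') = h1_pairing p y x + h1_pairing p y x'"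
    unfolding h1_pairing_def by (subst suminf_add[OF s s]) (simp add: algebra_simps)
  show "h1_pairing p (r *\<^sub>R x) y = r *\<^sub>R h1_pairing p x y"
    unfolding h1_pairing_def by (subst suminf_scaleR_right[OF s]) (simp add: scaleR_conv_of_real mult_ac)
  show "h1_pairing p y (r *\<^sub>R x) = r *\<^sub>R h1_pairing p y x"
    unfolding h1_pairing_def by (subst suminf_scaleR_right[OF s]) (simp add: scaleR_conv_of_real mult_ac)
  show "\<exists>K. \<forall>x y. norm (h1_pairing p x y) \<le> norm x * norm y * K"
    using norm_h1_pairing_le[OF assms] by (intro exI[of _ 1]) simp
qed

lemma cnj_h1_pairing:
  assumes "p \<le> 2"
  shows "cnj (h1_pairing p x y) = h1_pairing p y x"
  unfolding h1_pairing_def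
  by (subst bounded_linear.suminf[OF bounded_linear_cnj summable_h1_pairing_term[OF assms]])
    (simp add: mult_ac)

lemma h1_pairing_scaleC_right:
  assumes "p \<le> 2"
  shows "h1_pairing p x (h1_scaleC c y) = c * h1_pairing p x y"
  unfolding h1_pairing_def
  by (subst suminf_mult[OF summable_h1_pairing_term[OF assms], symmetric]) (simp add: mult_ac)

lemma Re_h1_pairing_self:
  assumes "p \<le> 2"
  shows "Re (h1_pairing p x x) = (\<Sum>n. (real n + 1) ^ p * (norm (h1_coeff x n))\<^sup>2)"
proof -
  have "cnj z * z = complex_of_real ((norm z)\<^sup>2)" for z
    unfolding complex_norm_square by (rule mult.commute)
  then have "Re (complex_of_real ((real n + 1) ^ p) * (cnj (h1_coeff x n) * h1_coeff x n))
      = (real n + 1) ^ p * (norm (h1_coeff x n))\<^sup>2" for n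
    by (metis Re_complex_of_real of_real_mult)
  then show ?thesis
    unfolding h1_pairing_def
    by (subst bounded_linear.suminf[OF bounded_linear_Re summable_h1_pairing_term[OF assms]]) simp
qed

lemma conformal_Q_eq_pairing: "conformal_Q (h1_coeff x) = Re (h1_pairing 1 x x)"
  by (simp add: conformal_Q_def Re_h1_pairing_self)

lemma conformal_E_eq_pairing: "conformal_E (h1_coeff x) = Re (h1_pairing 2 x x)"
  by (simp add: conformal_E_def Re_h1_pairing_self)

lemma norm_h1_eq_sqrt_pairing: "norm x = sqrt (Re (h1_pairing 2 x x))"
  by (simp add: norm_h1.rep_eq hs_norm_def Re_h1_pairing_self)

section \<open>The quartic form and its symmetries\<close>

definition quartic_index :: "(nat \<times> nat \<times> nat) set" where
  "quartic_index = (SIGMA n:UNIV. SIGMA j:UNIV. {..n + j})"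

definition quartic_term ::
  "(nat \<Rightarrow> complex) \<Rightarrow> (nat \<Rightarrow> complex) \<Rightarrow> (nat \<Rightarrow> complex) \<Rightarrow> (nat \<Rightarrow> complex) \<Rightarrow> nat \<times> nat \<times> nat \<Rightarrow> complex" where
  "quartic_term a b c d = (\<lambda>(n, j, k).
    of_nat (conformal_S n j k) * (cnj (a n) * cnj (b j) * c k * d (n + j - k)))"

text \<open>An unordered sum over triples instead of an iterated series, so that the symmetries of S
  act by permuting the index set.\<close>

definition quartic_form ::
  "(nat \<Rightarrow> complex) \<Rightarrow> (nat \<Rightarrow> complex) \<Rightarrow> (nat \<Rightarrow> complex) \<Rightarrow> (nat \<Rightarrow> complex) \<Rightarrow> complex" where
  "quartic_form a b c d = infsum (quartic_term a b c d) quartic_index"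

text \<open>The first argument is only required to be in l2, because (n + 1) times an h1 sequence
  will be inserted there. The bound S \<le> j + 1 loads the weight on b, and the Hankel estimate
  controls all finite boxes uniformly.\<close>

lemma summable_quartic_term:
  assumes a: "\<And>N. L2_set (\<lambda>n. norm (a n)) {..<N} \<le> A" and bcd: "b \<in> hs 1" "c \<in> hs 1" "d \<in> hs 1"
  shows "quartic_term a b c d summable_on quartic_index"
proof (rule abs_summable_summable, rule nonneg_bdd_above_summable_on)
  define B where "B = A * hs_norm 1 b * suminf (norm_convolution c d)"
  have A0: "0 \<le> A" using a[of 0] by simp
  have "sum (\<lambda>p. norm (quartic_term a b c d p)) F \<le> B" if F: "F \<subseteq> quartic_index" "finite F" for F
  proof -
    \<comment> \<open>A finite set of triples lies over a square in (n, j); then k \<le> n + j makes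
      the enclosing box finite.\<close>
    obtain N where N: "\<And>n j k. (n, j, k) \<in> F \<Longrightarrow> n < N \<and> j < N"
    proof -
      have "finite (fst ` F \<union> (fst \<circ> snd) ` F)" using F by auto
      then obtain N where "\<forall>m \<in> fst ` F \<union> (fst \<circ> snd) ` F. m < N"
        using finite_nat_set_iff_bounded by blast
      then show ?thesis by (intro that[of N]) force
    qed
    have "sum (\<lambda>p. norm (quartic_term a b c d p)) F
        \<le> sum (\<lambda>p. norm (quartic_term a b c d p)) (SIGMA n:{..<N}. SIGMA j:{..<N}. {..n + j})"
      using F N by (intro sum_mono2) (auto simp: quartic_index_def)
    also have "\<dots> = (\<Sum>n<N. \<Sum>j<N. \<Sum>k\<le>n + j. norm (quartic_term a b c d (n, j, k)))"
      by (simp add: sum.Sigma)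
    also have "\<dots> \<le> (\<Sum>n<N. \<Sum>j<N. norm (a n) * ((real j + 1) * norm (b j)) * norm_convolution c d (n + j))"
    proof (intro sum_mono)
      fix n j
      have "norm (quartic_term a b c d (n, j, k))
          \<le> (real j + 1) * (norm (a n) * norm (b j) * norm (c k) * norm (d (n + j - k)))" for k
        unfolding quartic_term_def case_prod_conv norm_mult complex_mod_cnj norm_of_nat
        by (intro mult_right_mono) (auto simp: conformal_S_def)
      then have "(\<Sum>k\<le>n + j. norm (quartic_term a b c d (n, j, k)))
          \<le> (\<Sum>k\<le>n + j. (real j + 1) * (norm (a n) * norm (b j) * norm (c k) * norm (d (n + j - k))))"
        by (rule sum_mono)
      also have "\<dots> = norm (a n) * ((real j + 1) * norm (b j)) * norm_convolution c d (n + j)"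
        by (simp add: norm_convolution_def sum_distrib_left mult_ac)
      finally show "(\<Sum>k\<le>n + j. norm (quartic_term a b c d (n, j, k)))
          \<le> norm (a n) * ((real j + 1) * norm (b j)) * norm_convolution c d (n + j)" .
    qed
    also have "\<dots> \<le> L2_set (\<lambda>n. norm (a n)) {..<N} * L2_set (\<lambda>j. (real j + 1) * norm (b j)) {..<N}
        * suminf (norm_convolution c d)"
      by (intro hankel_form_bound summable_norm_convolution bcd norm_convolution_nonneg) auto
    also have "\<dots> \<le> B"
      unfolding B_def
      by (intro mult_right_mono mult_mono a L2_set_weighted_le_hs_norm bcd A0 suminf_nonneg
          summable_norm_convolution norm_convolution_nonneg) auto
    finally show ?thesis .
  qed
  then show "bdd_above (sum (\<lambda>p. norm (quartic_term a b c d p)) ` {F. F \<subseteq> quartic_index \<and> finite F})"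
    by (intro bdd_aboveI2[of _ _ B]) auto
qed auto

lemma infsum_nat_eq_suminf:
  fixes f :: "nat \<Rightarrow> 'a::{topological_comm_monoid_add, t2_space}"
  shows "f summable_on UNIV \<Longrightarrow> infsum f UNIV = suminf f"
  by (metis has_sum_imp_sums has_sum_infsum sums_unique)

text \<open>Absolute convergence allows the return to iterated sums. The factor n + 1 undoes the
  division built into \<open>conformal_T_term\<close>.\<close>

lemma quartic_form_eq_suminf:
  assumes a: "\<And>N. L2_set (\<lambda>n. norm (a n)) {..<N} \<le> A" and bcd: "b \<in> hs 1" "c \<in> hs 1" "d \<in> hs 1"
  shows "quartic_form a b c d = (\<Sum>n. of_nat (n + 1) * (cnj (a n) * conformal_T_seq b c d n))"
proof -
  let ?t = "quartic_term a b c d"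
  have s: "(\<lambda>(n, p). ?t (n, p)) summable_on (SIGMA n:UNIV. SIGMA j:UNIV. {..n + j})"
    using summable_quartic_term[OF assms] by (simp add: quartic_index_def)
  have s': "(\<lambda>(j, k). ?t (n, j, k)) summable_on (SIGMA j:UNIV. {..n + j})" for n
    using summable_on_SigmaD1[OF s, of n] by (simp add: case_prod_unfold)
  have inner: "infsum (\<lambda>p. ?t (n, p)) (SIGMA j:UNIV. {..n + j})
      = of_nat (n + 1) * (cnj (a n) * conformal_T_seq b c d n)" for n
  proof -
    have "infsum (\<lambda>p. ?t (n, p)) (SIGMA j:UNIV. {..n + j}) = infsum (\<lambda>(j, k). ?t (n, j, k)) (SIGMA j:UNIV. {..n + j})"
      by (simp add: case_prod_unfold)
    also have "\<dots> = infsum (\<lambda>j. infsum (\<lambda>k. ?t (n, j, k)) {..n + j}) UNIV"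
      by (rule infsum_Sigma'_banach[OF s', symmetric])
    also have "\<dots> = (\<Sum>j. infsum (\<lambda>k. ?t (n, j, k)) {..n + j})"
      by (rule infsum_nat_eq_suminf[OF summable_on_Sigma_banach[OF s']])
    also have "\<dots> = (\<Sum>j. of_nat (n + 1) * cnj (a n) * conformal_T_term b c d n j)"
      by (intro suminf_cong)
        (simp add: quartic_term_def conformal_T_term_def sum_distrib_left atLeast0AtMost field_simps
          del: of_nat_Suc of_nat_add)
    also have "\<dots> = of_nat (n + 1) * cnj (a n) * conformal_T_seq b c d n"
      unfolding conformal_T_seq_def by (rule suminf_mult[OF summable_conformal_T_term[OF bcd]])
    finally show ?thesis by (simp only: mult.assoc)
  qed
  have "quartic_form a b c d = infsum (\<lambda>n. infsum (\<lambda>p. ?t (n, p)) (SIGMA j:UNIV. {..n + j})) UNIV"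
    unfolding infsum_Sigma'_banach[OF s] by (simp add: quartic_form_def quartic_index_def)
  also have "\<dots> = (\<Sum>n. infsum (\<lambda>p. ?t (n, p)) (SIGMA j:UNIV. {..n + j}))"
    by (rule infsum_nat_eq_suminf[OF summable_on_Sigma_banach[OF s]])
  finally show ?thesis
    unfolding inner .
qed

text \<open>This and the next two facts permute the four indices n, j, k, n + j - k, and S depends
  only on their minimum. The condition k \<le> n + j makes the subtractions exact.\<close>

lemma conformal_S_swap: "conformal_S j n k = conformal_S n j k"
  by (simp add: conformal_S_def insert_commute add.commute)

lemma conformal_S_reflect: "k \<le> n + j \<Longrightarrow> conformal_S n j (n + j - k) = conformal_S n j k"
  by (simp add: conformal_S_def insert_commute)

lemma conformal_S_exchange: "k \<le> n + j \<Longrightarrow> conformal_S k (n + j - k) n = conformal_S n j k"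
  by (simp add: conformal_S_def insert_commute)

text \<open>The reindexing map is an involution. Transporting summability along with the value lets
  a merely l2 argument move out of the first slot, where \<open>summable_quartic_term\<close> admits
  it, into the others.\<close>

lemma
  shows quartic_form_swap_left: "quartic_form b a c d = quartic_form a b c d"
    and summable_quartic_swap_left: "quartic_term b a c d summable_on quartic_index
      \<longleftrightarrow> quartic_term a b c d summable_on quartic_index"
  unfolding quartic_form_def
  by (rule infsum_reindex_bij_witness[of _ "\<lambda>(n, j, k). (j, n, k)" "\<lambda>(n, j, k). (j, n, k)"]
      summable_on_reindex_bij_witness[of _ "\<lambda>(n, j, k). (j, n, k)" "\<lambda>(n, j, k). (j, n, k)"];
      auto simp: quartic_index_def quartic_term_def conformal_S_swap add.commute mult_ac)+

lemma
  shows quartic_form_swap_right: "quartic_form a b d c = quartic_form a b c d"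
    and summable_quartic_swap_right: "quartic_term a b d c summable_on quartic_index
      \<longleftrightarrow> quartic_term a b c d summable_on quartic_index"
  unfolding quartic_form_def
  by (rule infsum_reindex_bij_witness[of _ "\<lambda>(n, j, k). (n, j, n + j - k)" "\<lambda>(n, j, k). (n, j, n + j - k)"]
      summable_on_reindex_bij_witness[of _ "\<lambda>(n, j, k). (n, j, n + j - k)" "\<lambda>(n, j, k). (n, j, n + j - k)"];
      auto simp: quartic_index_def quartic_term_def conformal_S_reflect mult_ac)+

text \<open>Conjugation exchanges the barred pair (n, j) with the unbarred pair (k, n + j - k). On
  the diagonal this makes the form real, which is the source of the conservation of Q.\<close>

lemma
  shows cnj_quartic_form: "cnj (quartic_form a b c d) = quartic_form c d a b"
    and summable_quartic_exchange: "quartic_term c d a b summable_on quartic_index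
      \<longleftrightarrow> quartic_term a b c d summable_on quartic_index"
proof -
  let ?\<sigma> = "\<lambda>(n, j, k). (k, n + j - k, n) :: nat \<times> nat \<times> nat"
  show "cnj (quartic_form a b c d) = quartic_form c d a b"
    unfolding quartic_form_def infsum_cnj[symmetric]
    by (rule infsum_reindex_bij_witness[of _ ?\<sigma> ?\<sigma>])
      (auto simp: quartic_index_def quartic_term_def conformal_S_exchange mult_ac)
  have "(\<lambda>p. cnj (quartic_term a b c d p)) summable_on quartic_index
      \<longleftrightarrow> quartic_term c d a b summable_on quartic_index"
    by (rule summable_on_reindex_bij_witness[of _ ?\<sigma> ?\<sigma>])
      (auto simp: quartic_index_def quartic_term_def conformal_S_exchange mult_ac)
  then show "quartic_term c d a b summable_on quartic_index
      \<longleftrightarrow> quartic_term a b c d summable_on quartic_index"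
    by simp
qed

lemma L2_set_norm_le_hs_norm:
  assumes "a \<in> hs 1"
  shows "L2_set (\<lambda>n. norm (a n)) {..<N} \<le> hs_norm 1 a"
proof -
  have "L2_set (\<lambda>n. norm (a n)) {..<N} \<le> L2_set (\<lambda>n. (real n + 1) * norm (a n)) {..<N}"
    by (intro L2_set_mono) (auto simp: mult_le_cancel_right1)
  then show ?thesis
    using L2_set_weighted_le_hs_norm[OF assms, of N] by linarith
qed

lemma h1_pairing_1_conformal_T:
  "h1_pairing 1 w (conformal_T x y z) = quartic_form (h1_coeff w) (h1_coeff x) (h1_coeff y) (h1_coeff z)"
  unfolding h1_pairing_def
    quartic_form_eq_suminf[OF L2_set_norm_le_hs_norm[OF h1_coeff] h1_coeff h1_coeff h1_coeff]
  by (simp add: conformal_T.rep_eq add.commute)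

lemma Im_h1_pairing_1_conformal_F: "Im (h1_pairing 1 x (conformal_F x)) = 0"
proof -
  have "cnj (h1_pairing 1 x (conformal_F x)) = h1_pairing 1 x (conformal_F x)"
    unfolding conformal_F_eq_T h1_pairing_1_conformal_T by (rule cnj_quartic_form)
  then show ?thesis
    by (simp add: complex_eq_iff)
qed

text \<open>Symmetrising the weight \<open>n + 1\<close> in \<open>n\<close> and \<open>j\<close> gives \<open>(n + j + 2) / 2\<close>, which is invariant
  under exchanging the pair \<open>(n, j)\<close> with \<open>(k, n + j - k)\<close>.\<close>

lemma Im_h1_pairing_2_conformal_F: "Im (h1_pairing 2 x (conformal_F x)) = 0"
proof -
  define a where "a = h1_coeff x"
  \<comment> \<open>One of the two powers of n + 1 is absorbed into the first argument; the other is
    supplied by \<open>quartic_form_eq_suminf\<close>.\<close>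
  define b where "b n = of_nat (n + 1) * a n" for n
  have a: "a \<in> hs 1" by (simp add: a_def h1_coeff)
  have b: "L2_set (\<lambda>n. norm (b n)) {..<N} \<le> hs_norm 1 a" for N
  proof -
    have "norm (b n) = (real n + 1) * norm (a n)" for n
      unfolding b_def norm_mult norm_of_nat by simp
    then show ?thesis
      using L2_set_weighted_le_hs_norm[OF a] by simp
  qed
  \<comment> \<open>The forms are combined termwise below, so each needs its own summability; the
    symmetries carry b from the first slot to the other three.\<close>
  have s1: "quartic_term b a a a summable_on quartic_index"
    by (rule summable_quartic_term[OF b a a a])
  have s2: "quartic_term a b a a summable_on quartic_index"
    using s1 summable_quartic_swap_left by blast
  have s3: "quartic_term a a b a summable_on quartic_index"
    using s1 summable_quartic_exchange by blast
  have s4: "quartic_term a a a b summable_on quartic_index"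
    using s3 summable_quartic_swap_right by blast
  have "2 * quartic_form b a a a = quartic_form b a a a + quartic_form a b a a"
    using quartic_form_swap_left[of a b a a] by simp
  also have "\<dots> = infsum (\<lambda>p. quartic_term b a a a p + quartic_term a b a a p) quartic_index"
    unfolding quartic_form_def by (rule infsum_add[OF s1 s2, symmetric])
  also have "\<dots> = infsum (\<lambda>p. quartic_term a a b a p + quartic_term a a a b p) quartic_index"
  proof (rule infsum_cong)
    fix p assume "p \<in> quartic_index"
    then obtain n j k where p: "p = (n, j, k)" "k \<le> n + j"
      by (auto simp: quartic_index_def)
    have "of_nat (n + 1) + of_nat (j + 1) = (of_nat (k + 1) + of_nat (n + j - k + 1) :: complex)"
      unfolding of_nat_add[symmetric] of_nat_eq_iff using p(2) by simp
    then have "(of_nat (n + 1) + of_nat (j + 1)) * quartic_term a a a a p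
        = (of_nat (k + 1) + of_nat (n + j - k + 1)) * quartic_term a a a a p"
      by (rule arg_cong)
    then show "quartic_term b a a a p + quartic_term a b a a p = quartic_term a a b a p + quartic_term a a a b p"
      by (simp add: p(1) quartic_term_def b_def algebra_simps del: of_nat_add of_nat_Suc)
  qed
  also have "\<dots> = quartic_form a a b a + quartic_form a a a b"
    unfolding quartic_form_def by (rule infsum_add[OF s3 s4])
  also have "\<dots> = 2 * cnj (quartic_form b a a a)"
    using quartic_form_swap_right[of a a a b] cnj_quartic_form[of b a a a] by simp
  finally have "Im (quartic_form b a a a) = 0"
    by (simp add: complex_eq_iff)
  moreover have "h1_pairing 2 x (conformal_F x) = quartic_form b a a a"
    unfolding quartic_form_eq_suminf[OF b a a a] h1_pairing_def conformal_F_eq_T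
    by (simp add: conformal_T.rep_eq a_def[symmetric] b_def power2_eq_square mult_ac add.commute)
  ultimately show ?thesis by simp
qed

lemma conformal_H_eq_pairing: "conformal_H (h1_coeff x) = h1_pairing 1 x (conformal_F x)"
proof -
  let ?a = "h1_coeff x"
  have "(\<Sum>j. \<Sum>k = 0..n + j. of_nat (conformal_S n j k) * (cnj (?a n) * cnj (?a j) * ?a k * ?a (n + j - k)))
      = of_nat (n + 1) * cnj (?a n) * conformal_T_seq ?a ?a ?a n" for n
    unfolding conformal_T_seq_def
    by (subst suminf_mult[OF summable_conformal_T_term[OF h1_coeff h1_coeff h1_coeff], symmetric])
      (simp add: conformal_T_term_def sum_distrib_left field_simps del: of_nat_Suc of_nat_add)
  then show ?thesis
    unfolding conformal_H_def h1_pairing_def conformal_F_eq_T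
    by (simp add: conformal_T.rep_eq mult_ac add.commute)
qed

section \<open>The flow\<close>

definition conformal_V :: "h1 \<Rightarrow> h1" where
  "conformal_V x = h1_scaleC (- \<i>) (conformal_F x)"

interpretation conformal_T: bounded_trilinear conformal_T "l1_embedding_const\<^sup>2"
  by (rule bounded_trilinear_conformal_T)

lemma conformal_V_scaleR: "conformal_V (r *\<^sub>R x) = r ^ 3 *\<^sub>R conformal_V x"
  by (simp add: conformal_V_def conformal_F_eq_T linear_scale[OF conformal_T.linear_1]
      linear_scale[OF conformal_T.linear_2] linear_scale[OF conformal_T.linear_3]
      linear_scale[OF bounded_linear.linear[OF bounded_linear_h1_scaleC]] power3_eq_cube)

lemma conformal_V_diff_le:
  assumes "norm x \<le> R" "norm y \<le> R"
  shows "norm (conformal_V x - conformal_V y) \<le> 3 * l1_embedding_const\<^sup>2 * R\<^sup>2 * norm (x - y)"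
proof -
  have "conformal_V x - conformal_V y = h1_scaleC (- \<i>) (conformal_F x - conformal_F y)"
    unfolding conformal_V_def
    by (rule linear_diff[OF bounded_linear.linear[OF bounded_linear_h1_scaleC], symmetric])
  then have "norm (conformal_V x - conformal_V y) \<le> norm (conformal_F x - conformal_F y)"
    using norm_h1_scaleC_le[of "- \<i>"] by simp
  also have "\<dots> \<le> 3 * l1_embedding_const\<^sup>2 * R\<^sup>2 * norm (x - y)"
    unfolding conformal_F_eq_T by (rule cubic_diff_le[OF bounded_trilinear_conformal_T assms])
  finally show ?thesis .
qed

lemma continuous_conformal_F:
  assumes "continuous_on UNIV x"
  shows "continuous_on UNIV (\<lambda>t. conformal_F (x t))"
  unfolding conformal_F_eq_T continuous_on_def
  by (intro ballI conformal_T.tendsto) (use assms in \<open>simp_all add: continuous_on_def\<close>)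

text \<open>Along a continuous curve the nonlinearity is continuous, so the integral equation may be
  differentiated; conversely the differential equation is integrated by the fundamental
  theorem.\<close>

lemma conformal_flow_solution_iff:
  "conformal_flow_solution UNIV \<alpha> \<longleftrightarrow> (\<forall>t. (\<alpha> has_vector_derivative conformal_V (\<alpha> t)) (at t))"
proof -
  interpret i: bounded_linear "h1_scaleC \<i>" by (rule bounded_linear_h1_scaleC)
  have minus_i: "h1_scaleC (- \<i>) x = - h1_scaleC \<i> x" for x
    by (rule h1_eqI) simp
  have i_i: "h1_scaleC \<i> (h1_scaleC \<i> x) = - x" for x
    by (rule h1_eqI) (simp add: mult.assoc[symmetric])
  show ?thesis
  proof
    assume "conformal_flow_solution UNIV \<alpha>"
    then have cont: "continuous_on UNIV \<alpha>" and
      sol: "\<And>t. \<exists>y. has_oriented_integral_from_0 (\<lambda>\<tau>. conformal_F (\<alpha> \<tau>)) t y \<and> \<alpha> t = \<alpha> 0 - h1_scaleC \<i> y"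
      by (auto simp: conformal_flow_solution_def)
    define P where "P = primitive_from_0 (\<lambda>\<tau>. conformal_F (\<alpha> \<tau>))"
    have P: "(P has_vector_derivative conformal_F (\<alpha> t)) (at t)" for t
      unfolding P_def by (rule primitive_from_0_has_vector_derivative[OF continuous_conformal_F[OF cont]])
    have "\<alpha> t = \<alpha> 0 - h1_scaleC \<i> (P t)" for t
    proof -
      obtain y where y: "has_oriented_integral_from_0 (\<lambda>\<tau>. conformal_F (\<alpha> \<tau>)) t y" "\<alpha> t = \<alpha> 0 - h1_scaleC \<i> y"
        using sol by blast
      \<comment> \<open>The integral in the definition of a solution is existentially quantified;
        uniqueness of integrals identifies it with the primitive.\<close>
      have "y = P t"
      proof (cases "0 \<le> t")
        case True
        then show ?thesis
          using y(1) unfolding P_def primitive_from_0_def has_oriented_integral_from_0_def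
          by (simp add: integral_unique)
      next
        case False
        then have "((\<lambda>\<tau>. conformal_F (\<alpha> \<tau>)) has_integral - y) {t..0}"
          using y(1) by (simp add: has_oriented_integral_from_0_def)
        from integral_unique[OF this] show ?thesis
          using False by (simp add: P_def primitive_from_0_def)
      qed
      then show ?thesis using y(2) by simp
    qed
    then have \<alpha>: "\<alpha> = (\<lambda>t. \<alpha> 0 - h1_scaleC \<i> (P t))" by (rule ext)
    have "((\<lambda>t. \<alpha> 0 - h1_scaleC \<i> (P t)) has_vector_derivative 0 - h1_scaleC \<i> (conformal_F (\<alpha> t))) (at t)" for t
      by (intro has_vector_derivative_diff has_vector_derivative_const i.has_vector_derivative P)
    then show "\<forall>t. (\<alpha> has_vector_derivative conformal_V (\<alpha> t)) (at t)"
      unfolding \<alpha>[symmetric] by (simp add: conformal_V_def minus_i)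
  next
    assume \<alpha>: "\<forall>t. (\<alpha> has_vector_derivative conformal_V (\<alpha> t)) (at t)"
    have cont: "continuous_on UNIV \<alpha>"
      using vector_derivative_imp_continuous_on[OF \<alpha>[rule_format]] by simp
    \<comment> \<open>Since the derivative of \<alpha> is -\<i> F, the curve \<i> \<alpha> is an
      antiderivative of F.\<close>
    have F: "((\<lambda>t. h1_scaleC \<i> (\<alpha> t)) has_vector_derivative conformal_F (\<alpha> t)) (at t)" for t
      using i.has_vector_derivative[OF \<alpha>[rule_format, of t]]
      by (simp add: conformal_V_def minus_i i_i linear_neg[OF i.linear])
    have "has_oriented_integral_from_0 (\<lambda>\<tau>. conformal_F (\<alpha> \<tau>)) t (primitive_from_0 (\<lambda>\<tau>. conformal_F (\<alpha> \<tau>)) t)" for t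
    proof -
      have "(\<lambda>\<tau>. conformal_F (\<alpha> \<tau>)) integrable_on {a..b}" for a b
        by (rule integrable_continuous_real[OF continuous_on_subset[OF continuous_conformal_F[OF cont] subset_UNIV]])
      then show ?thesis
        by (simp add: has_oriented_integral_from_0_def primitive_from_0_def integrable_integral)
    qed
    moreover have "\<alpha> t = \<alpha> 0 - h1_scaleC \<i> (primitive_from_0 (\<lambda>\<tau>. conformal_F (\<alpha> \<tau>)) t)" for t
      unfolding primitive_from_0_eq_diff[OF F] by (simp add: i.diff i_i)
    ultimately show "conformal_flow_solution UNIV \<alpha>"
      using cont is_interval_univ unfolding conformal_flow_solution_def by blast
  qed
qed

section \<open>Conservation laws along the flow\<close>

lemma has_vector_derivative_zero_imp_eq:
  fixes f :: "real \<Rightarrow> 'a::real_normed_vector"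
  assumes "\<And>t. (f has_vector_derivative 0) (at t)"
  shows "f s = f t"
proof (rule has_vector_derivative_zero_constant[OF convex_UNIV assms])
  fix c assume "\<And>x. x \<in> UNIV \<Longrightarrow> f x = c"
  then show ?thesis by simp
qed

text \<open>Multiplication by -\<i> turns the vanishing imaginary parts of the pairings with F into
  vanishing real parts.\<close>

lemma Re_h1_pairing_conformal_V:
  assumes "p = 1 \<or> p = 2"
  shows "Re (h1_pairing p x (conformal_V x)) = 0"
proof -
  have "h1_pairing p x (conformal_V x) = - \<i> * h1_pairing p x (conformal_F x)"
    unfolding conformal_V_def by (rule h1_pairing_scaleC_right) (use assms in auto)
  then show ?thesis
    using assms Im_h1_pairing_1_conformal_F[of x] Im_h1_pairing_2_conformal_F[of x] by auto
qed

text \<open>The factor r lets one statement cover both the original equation, r = 1, and the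
  truncated one. Being real, it preserves the vanishing of the real part of the pairing with the
  velocity.\<close>

lemma Re_h1_pairing_self_constant:
  assumes p: "p = 1 \<or> p = 2"
    and x: "\<And>t. (x has_vector_derivative r t *\<^sub>R conformal_V (x t)) (at t)"
  shows "Re (h1_pairing p (x t) (x t)) = Re (h1_pairing p (x 0) (x 0))"
proof (rule has_vector_derivative_zero_imp_eq[where f = "\<lambda>t. Re (h1_pairing p (x t) (x t))"])
  fix t
  have p2: "p \<le> 2" using p by auto
  interpret pairing: bounded_bilinear "h1_pairing p"
    by (rule bounded_bilinear_h1_pairing[OF p2])
  have "Re (h1_pairing p (x t) (r t *\<^sub>R conformal_V (x t))) = 0"
    by (simp add: pairing.scaleR_right Re_h1_pairing_conformal_V[OF p])
  moreover have "Re (h1_pairing p (r t *\<^sub>R conformal_V (x t)) (x t)) = Re (h1_pairing p (x t) (r t *\<^sub>R conformal_V (x t)))"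
    by (subst cnj_h1_pairing[OF p2, symmetric]) simp
  moreover have "((\<lambda>t. Re (h1_pairing p (x t) (x t))) has_vector_derivative
      Re (h1_pairing p (x t) (r t *\<^sub>R conformal_V (x t)) + h1_pairing p (r t *\<^sub>R conformal_V (x t)) (x t))) (at t)"
    by (intro bounded_linear.has_vector_derivative[OF bounded_linear_Re] pairing.has_vector_derivative x)
  ultimately show "((\<lambda>t. Re (h1_pairing p (x t) (x t))) has_vector_derivative 0) (at t)"
    by simp
qed

text \<open>By the symmetries of the quartic form, the four slots of H contribute P twice and cnj P
  twice, where P pairs V with F. As V = -\<i> F, P is \<i> times a real number, so P + cnj P
  vanishes.\<close>

lemma conformal_H_constant:
  assumes x: "\<And>t. (x has_vector_derivative conformal_V (x t)) (at t)"
  shows "conformal_H (h1_coeff (x t)) = conformal_H (h1_coeff (x 0))"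
proof (rule has_vector_derivative_zero_imp_eq[where f = "\<lambda>t. conformal_H (h1_coeff (x t))"])
  fix t
  interpret pairing: bounded_bilinear "h1_pairing 1"
    by (rule bounded_bilinear_h1_pairing) simp
  define y v where "y = x t" and "v = conformal_V y"
  define P where "P = h1_pairing 1 v (conformal_T y y y)"
  have "P = cnj (h1_pairing 1 (conformal_F y) v)"
    unfolding P_def conformal_F_eq_T by (rule cnj_h1_pairing[symmetric]) simp
  also have "h1_pairing 1 (conformal_F y) v = - \<i> * h1_pairing 1 (conformal_F y) (conformal_F y)"
    unfolding v_def conformal_V_def by (rule h1_pairing_scaleC_right) simp
  also have "Re (cnj \<dots>) = 0"
  proof -
    have "cnj (h1_pairing 1 (conformal_F y) (conformal_F y)) = h1_pairing 1 (conformal_F y) (conformal_F y)"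
      by (rule cnj_h1_pairing) simp
    then show ?thesis by (simp add: complex_eq_iff)
  qed
  finally have "P + cnj P = 0"
    by (simp add: complex_eq_iff)
  have 1: "h1_pairing 1 y (conformal_T v y y) = P"
    unfolding P_def h1_pairing_1_conformal_T by (rule quartic_form_swap_left)
  have 2: "h1_pairing 1 y (conformal_T y v y) = cnj P"
    unfolding P_def h1_pairing_1_conformal_T by (rule cnj_quartic_form[symmetric])
  have 3: "h1_pairing 1 y (conformal_T y y v) = cnj P"
    unfolding 2[symmetric] h1_pairing_1_conformal_T by (rule quartic_form_swap_right)
  have "((\<lambda>t. h1_pairing 1 (x t) (conformal_T (x t) (x t) (x t))) has_vector_derivative
      h1_pairing 1 (x t) (conformal_T (conformal_V (x t)) (x t) (x t) + conformal_T (x t) (conformal_V (x t)) (x t)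
        + conformal_T (x t) (x t) (conformal_V (x t)))
      + h1_pairing 1 (conformal_V (x t)) (conformal_T (x t) (x t) (x t))) (at t)"
    by (intro pairing.has_vector_derivative conformal_T.has_vector_derivative x)
  also have "h1_pairing 1 (x t) (conformal_T (conformal_V (x t)) (x t) (x t) + conformal_T (x t) (conformal_V (x t)) (x t)
        + conformal_T (x t) (x t) (conformal_V (x t)))
      + h1_pairing 1 (conformal_V (x t)) (conformal_T (x t) (x t) (x t)) = 2 * (P + cnj P)"
    unfolding y_def[symmetric] v_def[symmetric] pairing.add_right 1 2 3 P_def[symmetric]
    by simp
  finally show "((\<lambda>t. conformal_H (h1_coeff (x t))) has_vector_derivative 0) (at t)"
    unfolding conformal_H_eq_pairing conformal_F_eq_T \<open>P + cnj P = 0\<close> by simp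
qed

theorem theorem1:
  fixes a :: h1
  shows "\<exists>\<alpha> :: real \<Rightarrow> h1.
    conformal_flow_solution UNIV \<alpha> \<and> \<alpha> 0 = a \<and>
    (\<forall>\<beta>. conformal_flow_solution UNIV \<beta> \<and> \<beta> 0 = a \<longrightarrow> \<beta> = \<alpha>) \<and>
    (\<forall>t. conformal_H (h1_coeff (\<alpha> t)) = conformal_H (h1_coeff (\<alpha> 0)) \<and>
         conformal_Q (h1_coeff (\<alpha> t)) = conformal_Q (h1_coeff (\<alpha> 0)) \<and>
         conformal_E (h1_coeff (\<alpha> t)) = conformal_E (h1_coeff (\<alpha> 0)))"
proof -
  \<comment> \<open>The added 1 keeps R positive when a = 0 and leaves the sphere of radius
    \<open>norm a\<close> inside the ball where the retraction is the identity.\<close>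
  define R where "R = norm a + 1"
  define G where "G x = conformal_V (radial_retraction R x)" for x
  \<comment> \<open>The Lipschitz constant of V on the ball, times 2 for the retraction; adding 1
    makes it strictly positive.\<close>
  define L where "L = 3 * l1_embedding_const\<^sup>2 * R\<^sup>2 * 2 + 1"
  have R: "0 < R" by (simp add: R_def add_nonneg_pos)
  have L: "0 < L" by (simp add: L_def add_nonneg_pos)
  have G_eq_V: "G x = conformal_V x" if "norm x = norm a" for x
    using that by (simp add: G_def radial_retraction_def R_def)
  \<comment> \<open>Outside the ball, homogeneity of degree 3 gives the factor (R / norm x) ^
    3.\<close>
  have "\<forall>x. \<exists>r. G x = r *\<^sub>R conformal_V x"
  proof
    fix x
    show "\<exists>r. G x = r *\<^sub>R conformal_V x"
    proof (cases "norm x \<le> R")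
      case True
      then show ?thesis by (intro exI[of _ 1]) (simp add: G_def radial_retraction_def)
    next
      case False
      then show ?thesis
        by (intro exI[of _ "(R / norm x) ^ 3"]) (simp add: G_def radial_retraction_def conformal_V_scaleR)
    qed
  qed
  from choice[OF this] obtain r where r: "\<forall>x. G x = r x *\<^sub>R conformal_V x" ..
  have lip: "norm (G x - G y) \<le> L * norm (x - y)" for x y
  proof -
    have "norm (G x - G y) \<le> 3 * l1_embedding_const\<^sup>2 * R\<^sup>2 * norm (radial_retraction R x - radial_retraction R y)"
      unfolding G_def using R by (intro conformal_V_diff_le norm_radial_retraction_le) auto
    also have "\<dots> \<le> 3 * l1_embedding_const\<^sup>2 * R\<^sup>2 * (2 * norm (x - y))"
      by (intro mult_left_mono norm_radial_retraction_diff_le[OF R]) auto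
    also have "\<dots> \<le> L * norm (x - y)"
      by (simp add: L_def algebra_simps)
    finally show ?thesis .
  qed
  have norm_constant: "norm (x t) = norm (x 0)"
    if "\<And>t. (x has_vector_derivative r t *\<^sub>R conformal_V (x t)) (at t)" for x r t
    unfolding norm_h1_eq_sqrt_pairing using Re_h1_pairing_self_constant[of 2, OF _ that] by simp
  obtain \<alpha> where \<alpha>: "\<alpha> 0 = a" "\<forall>t. (\<alpha> has_vector_derivative G (\<alpha> t)) (at t)"
    and unique: "\<forall>\<beta> K. \<beta> 0 = a \<and> (\<forall>t. (\<beta> has_vector_derivative G (\<beta> t)) (at t)) \<and> (\<forall>t. norm (\<beta> t) \<le> K)
      \<longrightarrow> \<beta> = \<alpha>"
    using lipschitz_ode_global[OF L lip] by blast
  \<comment> \<open>The truncated solution moves along real multiples of V, so its norm stays at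
    \<open>norm a\<close>, where G and V agree.\<close>
  have "norm (\<alpha> t) = norm a" for t
    using norm_constant[of \<alpha> "\<lambda>t. r (\<alpha> t)" t] \<alpha> by (simp add: r)
  then have \<alpha>': "(\<alpha> has_vector_derivative conformal_V (\<alpha> t)) (at t)" for t
    using \<alpha>(2) by (metis G_eq_V)
  \<comment> \<open>A solution of the original equation has constant norm as well; hence it is
    bounded and solves the truncated equation, where uniqueness is available.\<close>
  have "\<beta> = \<alpha>" if "conformal_flow_solution UNIV \<beta>" "\<beta> 0 = a" for \<beta>
  proof -
    have \<beta>: "(\<beta> has_vector_derivative conformal_V (\<beta> t)) (at t)" for t
      using that(1) by (simp add: conformal_flow_solution_iff)
    have n: "norm (\<beta> t) = norm a" for t
      using norm_constant[of \<beta> "\<lambda>_. 1" t] \<beta> that(2) by simp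
    show ?thesis
      by (rule unique[rule_format, of \<beta> "norm a"]) (use that(2) n \<beta> in \<open>simp add: G_eq_V\<close>)
  qed
  moreover have "conformal_Q (h1_coeff (\<alpha> t)) = conformal_Q (h1_coeff (\<alpha> 0))"
    and "conformal_E (h1_coeff (\<alpha> t)) = conformal_E (h1_coeff (\<alpha> 0))" for t
    unfolding conformal_Q_eq_pairing conformal_E_eq_pairing
    by (rule Re_h1_pairing_self_constant[where r = "\<lambda>_. 1"]; simp add: \<alpha>')+
  moreover have "conformal_flow_solution UNIV \<alpha>"
    using \<alpha>' by (simp add: conformal_flow_solution_iff)
  ultimately show ?thesis
    using \<alpha>(1) conformal_H_constant[OF \<alpha>'] by blast
qed

end
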